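(* Fix positive integers $L$ and $R$. Let $F_0(x,q,r)=\sum_w x^{m(w)}q^{\ell(w)}r^{\alpha(w)}$, where the sum is over all $(L)(M)(R)$-words $w$ (over all $M\ge1$) that have at least two $M$-descents and have no $M$-letter to the right of the leftmost $R$-letter. Then, writing $F_0(r)$ for $F_0(x,q,r)$, $$F_0(r)=\frac{E_0(r)}{1-xr}+\frac{xqr}{(1-qr)(1-xr)}F_0(1)-\frac{xqr}{(1-qr)(1-xr)}F_0(qr),$$ where $$E_0(r)=\sum_{m\ge0}\sum_{i=1}^{m-1}x^{m+1}\binom{L+i}{L}_q\left(\binom{m}{i}_q-1\right)\left(\sum_{k=1}^{m-i-1}q^kr^k\right).$$
   Context: For positive integers $L,M,R$, an $(L)(M)(R)$-word is a permutation of $\{1,\dots,L+M+R\}$ that is $321$-avoiding (no positions $i<j<k$ with $w_i>w_j>w_k$), in which the numbers $1,\dots,L$ appear in increasing order, the numbers $L+M+1,\dots,L+M+R$ appear in increasing order, and every number in $\{1,\dots,L\}$ appears to the left of every number in $\{L+M+1,\dots,L+M+R\}$. Entries in $\{1,\dots,L\}$ are called $L$-letters, those in $\{L+1,\dots,L+M\}$ $M$-letters, and those in $\{L+M+1,\dots,L+M+R\}$ $R$-letters. The word has an $M$-descent in position $i$ if the $i$-th $M$-letter (from the left) is larger than the $(i+1)$-st $M$-letter. Statistics: $m(w)=M$; $\ell(w)$ is the number of inversions (pairs of positions $i<j$ with $w_i>w_j$); $\alpha(w)$ is the number of $M$-letters after the last $M$-descent and before the leftmost $R$-letter. The $q$-binomial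 coefficient is $\binom{n}{k}_q=\frac{(1-q^n)(1-q^{n-1})\cdots(1-q^{n-k+1})}{(1-q^k)(1-q^{k-1})\cdots(1-q)}$. *)

theory Defs
  imports
    "HOL-Computational_Algebra.Computational_Algebra"
    "HOL-Combinatorics.Multiset_Permutations"
begin

text \<open>
  A word is the list of its letters from left to right, so list index \<open>i\<close> is position \<open>i + 1\<close>.
\<close>

definition avoids_321 :: "nat list \<Rightarrow> bool" where
  "avoids_321 w \<longleftrightarrow>
     \<not> (\<exists>i j k. i < j \<and> j < k \<and> k < length w \<and> w ! i > w ! j \<and> w ! j > w ! k)"

definition L_letter :: "nat \<Rightarrow> nat \<Rightarrow> bool" where
  "L_letter L a \<longleftrightarrow> 1 \<le> a \<and> a \<le> L"

definition M_letter :: "nat \<Rightarrow> nat \<Rightarrow> nat \<Rightarrow> bool" where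
  "M_letter L M a \<longleftrightarrow> L + 1 \<le> a \<and> a \<le> L + M"

definition R_letter :: "nat \<Rightarrow> nat \<Rightarrow> nat \<Rightarrow> nat \<Rightarrow> bool" where
  "R_letter L M R a \<longleftrightarrow> L + M + 1 \<le> a \<and> a \<le> L + M + R"

definition LMR_words :: "nat \<Rightarrow> nat \<Rightarrow> nat \<Rightarrow> nat list set" where
  "LMR_words L M R =
     {w \<in> permutations_of_set {1..L + M + R}.
        avoids_321 w \<and>
        sorted_wrt (<) (filter (L_letter L) w) \<and>
        sorted_wrt (<) (filter (R_letter L M R) w) \<and>
        (\<forall>i<length w. \<forall>j<length w. L_letter L (w ! i) \<and> R_letter L M R (w ! j) \<longrightarrow> i < j)}"

definition M_positions :: "nat \<Rightarrow> nat \<Rightarrow> nat list \<Rightarrow> nat list" where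
  "M_positions L M w = filter (\<lambda>p. M_letter L M (w ! p)) [0..<length w]"

text \<open>
  M-letters are also numbered from \<open>0\<close>: \<open>i \<in> M_descents L M w\<close> is an M-descent in position
  \<open>i + 1\<close> of the usual numbering, comparing the M-letters number \<open>i\<close> and \<open>i + 1\<close>.
\<close>

definition M_descents :: "nat \<Rightarrow> nat \<Rightarrow> nat list \<Rightarrow> nat set" where
  "M_descents L M w =
     (let ps = M_positions L M w
      in {i. Suc i < length ps \<and> w ! (ps ! i) > w ! (ps ! Suc i)})"

definition inv_count :: "nat list \<Rightarrow> nat" where
  "inv_count w = card {(i, j). i < j \<and> j < length w \<and> w ! i > w ! j}"

text \<open>
  If \<open>i\<close> is the last M-descent, the M-letters after it are those numbered \<open>i + 1, i + 2, \<dots>\<close>: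
  the smaller letter of the descending pair counts, the larger one does not.  A position is
  left of the leftmost R-letter iff it is left of every R-letter.
\<close>

definition alpha :: "nat \<Rightarrow> nat \<Rightarrow> nat \<Rightarrow> nat list \<Rightarrow> nat" where
  "alpha L M R w =
     (let ps = M_positions L M w
      in card {k. k < length ps \<and>
                  (\<forall>i\<in>M_descents L M w. i < k) \<and>
                  (\<forall>j<length w. R_letter L M R (w ! j) \<longrightarrow> ps ! k < j)})"

definition F0_words :: "nat \<Rightarrow> nat \<Rightarrow> nat \<Rightarrow> nat list set" where
  "F0_words L M R =
     {w \<in> LMR_words L M R.
        card (M_descents L M w) \<ge> 2 \<and>
        \<not> (\<exists>i j. i < j \<and> j < length w \<and> R_letter L M R (w ! i) \<and> M_letter L M (w ! j))}"

text \<open>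
  Generating functions are power series in \<open>x = fps_X\<close>.  Each coefficient of \<open>F0\<close> is a finite
  sum, polynomial in \<open>q\<close> and \<open>r\<close>, so substituting for \<open>r\<close> amounts to passing another argument.
\<close>

definition F0 :: "nat \<Rightarrow> nat \<Rightarrow> 'a::field \<Rightarrow> 'a \<Rightarrow> 'a fps" where
  "F0 L R q r =
     Abs_fps (\<lambda>M. if M \<ge> 1 then (\<Sum>w\<in>F0_words L M R. q ^ inv_count w * r ^ alpha L M R w) else 0)"

text \<open>
  The \<open>q\<close>-binomial coefficient for \<open>k \<le> n\<close> and \<open>q\<close> not a root of unity.
\<close>

definition qbinom :: "nat \<Rightarrow> nat \<Rightarrow> 'a::field \<Rightarrow> 'a" where
  "qbinom n k q = (\<Prod>j<k. 1 - q ^ (n - j)) / (\<Prod>j<k. 1 - q ^ (k - j))"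

definition E0 :: "nat \<Rightarrow> 'a::field \<Rightarrow> 'a \<Rightarrow> 'a fps" where
  "E0 L q r =
     fps_X * Abs_fps (\<lambda>m. \<Sum>i\<in>{1..<m}.
       qbinom (L + i) L q * (qbinom m i q - 1) * (\<Sum>k\<in>{1..<m - i}. q ^ k * r ^ k))"

text \<open>
  The indeterminates \<open>q\<close> and \<open>r\<close> as elements of the field \<open>\<rat>(q, r)\<close>, represented as the
  fraction field of \<open>\<int>[q][r]\<close>: the inner polynomial variable is \<open>q\<close>, the outer one is \<open>r\<close>.
\<close>

type_synonym ratfun_qr = "int poly poly fract"

definition q_var :: ratfun_qr where
  "q_var = Fract [:[:0, 1:]:] 1"

definition r_var :: ratfun_qr where
  "r_var = Fract [:0, 1:] 1"

end

theory Submission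
  imports Defs
begin

text \<open>
  The words counted by \<open>F0\<close> are the words \<open>u\<close> on \<open>{1..L + M}\<close> with two M-descents, followed by all the
  R-letters in increasing order.  Remove the largest letter from such a word of size \<open>M + 1\<close>; let
  \<open>k\<close> be the number of letters behind it, which contributes \<open>k\<close> inversions.  If the remaining word
  still has two M-descents and its last run has length \<open>a\<close>, then \<open>k\<close> takes every value in
  \<open>{0..a}\<close>; the new last run has length \<open>a + 1\<close> for \<open>k = 0\<close>, and \<open>k\<close> otherwise.  Summing the
  geometric series gives \<open>x r F0(r)\<close> and the difference of \<open>F0(1)\<close> and \<open>F0(q r)\<close>.  If it has exactly
  one M-descent, then \<open>k\<close> takes every value in \<open>{1..<a}\<close>; such words are a shuffle of the L-letters
  with an increasing word, followed by an increasing word, so they are counted by products of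
  \<open>q\<close>-binomial coefficients, which gives \<open>E0\<close>.
\<close>


section \<open>Recursive forms of the word statistics\<close>

primrec invs :: "'a::linorder list \<Rightarrow> nat" where
  "invs [] = 0"
| "invs (x # xs) = length (filter (\<lambda>y. y < x) xs) + invs xs"

primrec av321 :: "'a::linorder list \<Rightarrow> bool" where
  "av321 [] \<longleftrightarrow> True"
| "av321 (x # xs) \<longleftrightarrow> sorted (filter (\<lambda>y. y < x) xs) \<and> av321 xs"

fun des :: "'a::linorder list \<Rightarrow> nat" where
  "des (x # y # zs) = (if y < x then 1 else 0) + des (y # zs)"
| "des _ = 0"

text \<open>The length of the longest increasing suffix: on the list of M-letters this is \<open>\<alpha>\<close>.\<close>

primrec runlen :: "'a::linorder list \<Rightarrow> nat" where
  "runlen [] = 0"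
| "runlen (x # xs) = (if sorted (x # xs) then Suc (length xs) else runlen xs)"

lemma inv_count_eq: "inv_count w = invs w"
proof (induction w)
  case Nil
  then show ?case by (simp add: inv_count_def)
next
  case (Cons x w)
  let ?S = "{(i, j). i < j \<and> j < length w \<and> w ! i > w ! j}"
  let ?N = "{j. j < length w \<and> w ! j < x}"
  have fin: "finite ?S"
    by (rule finite_subset[of _ "{..<length w} \<times> {..<length w}"]) auto
  have "{(i, j). i < j \<and> j < length (x # w) \<and> (x # w) ! i > (x # w) ! j}
      = (\<lambda>j. (0, Suc j)) ` ?N \<union> (\<lambda>(i, j). (Suc i, Suc j)) ` ?S" (is "?A = ?B")
  proof (rule set_eqI, clarify)
    fix i j
    show "(i, j) \<in> ?A \<longleftrightarrow> (i, j) \<in> ?B"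
      by (cases i; cases j) (auto simp: image_iff)
  qed
  then have "inv_count (x # w)
      = card ((\<lambda>j. (0::nat, Suc j)) ` ?N \<union> (\<lambda>(i, j). (Suc i, Suc j)) ` ?S)"
    by (simp only: inv_count_def)
  also have "\<dots> = card ((\<lambda>j. (0::nat, Suc j)) ` ?N) + card ((\<lambda>(i, j). (Suc i, Suc j)) ` ?S)"
    using fin by (intro card_Un_disjoint) auto
  also have "\<dots> = card ?N + card ?S"
    by (intro arg_cong2[where f = "(+)"] card_image) (auto simp: inj_on_def)
  finally show ?case
    using Cons.IH by (simp add: inv_count_def length_filter_conv_card)
qed

lemma sorted_filter_nth:
  "sorted (filter P w) \<longleftrightarrow>
    (\<forall>i j. i < j \<and> j < length w \<and> P (w ! i) \<and> P (w ! j) \<longrightarrow> w ! i \<le> w ! j)"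
proof (induction w)
  case (Cons x w)
  have "(\<forall>i j. i < j \<and> j < length (x # w) \<and> P ((x # w) ! i) \<and> P ((x # w) ! j)
          \<longrightarrow> (x # w) ! i \<le> (x # w) ! j) \<longleftrightarrow>
        (P x \<longrightarrow> (\<forall>y\<in>set w. P y \<longrightarrow> x \<le> y)) \<and>
        (\<forall>i j. i < j \<and> j < length w \<and> P (w ! i) \<and> P (w ! j) \<longrightarrow> w ! i \<le> w ! j)"
    (is "?A \<longleftrightarrow> ?B")
  proof
    assume A: ?A
    have "P x \<Longrightarrow> y \<in> set w \<Longrightarrow> P y \<Longrightarrow> x \<le> y" for y
      using A[rule_format, of 0 "Suc j" for j] by (auto simp: in_set_conv_nth)
    moreover have "i < j \<Longrightarrow> j < length w \<Longrightarrow> P (w ! i) \<Longrightarrow> P (w ! j) \<Longrightarrow> w ! i \<le> w ! j" for i j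
      using A[rule_format, of "Suc i" "Suc j"] by auto
    ultimately show ?B by blast
  next
    assume ?B
    then show ?A
      by (auto simp: nth_Cons split: nat.splits)
  qed
  with Cons.IH show ?case by auto
qed simp

text \<open>A 321 pattern either starts at the head \<open>x\<close>, and then its other two letters
  form an inversion among the letters below \<open>x\<close>, or it lies in the tail.\<close>

lemma avoids_321_eq: "avoids_321 w \<longleftrightarrow> av321 w"
proof (induction w)
  case Nil
  then show ?case by (simp add: avoids_321_def)
next
  case (Cons x w)
  have "(\<exists>i j k. i < j \<and> j < k \<and> k < length (x # w) \<and> (x # w) ! i > (x # w) ! j \<and> (x # w) ! j > (x # w) ! k)
    \<longleftrightarrow> (\<exists>j k. j < k \<and> k < length w \<and> w ! j < x \<and> w ! k < w ! j)
      \<or> (\<exists>i j k. i < j \<and> j < k \<and> k < length w \<and> w ! i > w ! j \<and> w ! j > w ! k)" (is "?A \<longleftrightarrow> ?B \<or> ?C")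
  proof (intro iffI)
    assume ?A
    then obtain i j k where h: "i < j" "j < k" "k < length (x # w)"
      "(x # w) ! i > (x # w) ! j" "(x # w) ! j > (x # w) ! k" by blast
    from h(1,2) obtain j' k' where "j = Suc j'" "k = Suc k'" by (metis not0_implies_Suc not_less_zero)
    with h show "?B \<or> ?C" by (cases i) auto
  next
    assume "?B \<or> ?C"
    then show ?A
    proof
      assume ?B
      then obtain j k where "j < k \<and> k < length w \<and> w ! j < x \<and> w ! k < w ! j" by blast
      then show ?A by (intro exI[of _ 0] exI[of _ "Suc j"] exI[of _ "Suc k"]) simp
    next
      assume ?C
      then obtain i j k where "i < j \<and> j < k \<and> k < length w \<and> w ! i > w ! j \<and> w ! j > w ! k" by blast
      then show ?A by (intro exI[of _ "Suc i"] exI[of _ "Suc j"] exI[of _ "Suc k"]) simp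
    qed
  qed
  moreover have "\<not> ?B \<longleftrightarrow> sorted (filter (\<lambda>y. y < x) w)"
    unfolding sorted_filter_nth by (meson leD leI less_trans)
  ultimately show ?case using Cons.IH by (simp add: avoids_321_def del: length_Cons)
qed

lemma des_eq_card: "card {i. Suc i < length xs \<and> xs ! i > xs ! Suc i} = des xs"
proof (induction xs rule: des.induct)
  case (1 x y zs)
  let ?D = "{i. Suc i < length (y # zs) \<and> (y # zs) ! i > (y # zs) ! Suc i}"
  have "{i. Suc i < length (x # y # zs) \<and> (x # y # zs) ! i > (x # y # zs) ! Suc i}
      = (if y < x then {0} else {}) \<union> Suc ` ?D" (is "?A = ?B")
  proof (rule set_eqI)
    fix i show "i \<in> ?A \<longleftrightarrow> i \<in> ?B" by (cases i) auto
  qed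
  then have "card ?A = card ((if y < x then {0} else {}) \<union> Suc ` ?D)" by (simp only:)
  also have "\<dots> = (if y < x then 1 else 0) + card ?D"
    by (subst card_Un_disjoint) (auto simp: card_image)
  finally show ?case using 1 by simp
qed auto

lemma des_0_iff: "des xs = 0 \<longleftrightarrow> sorted xs"
  by (induction xs rule: des.induct) (auto simp: sorted2 sorted1 not_less simp del: sorted_wrt.simps(2))

text \<open>The set collects the indices beyond every descent, as in \<open>alpha\<close>. If a
  descent exists, index 0 is not beyond it, so the set is the shifted set of the tail; without
  descents every index qualifies.\<close>

lemma runlen_eq_card:
  "card {k. k < length xs \<and> (\<forall>i. Suc i < length xs \<and> xs ! i > xs ! Suc i \<longrightarrow> i < k)} = runlen xs"
proof (induction xs)
  case (Cons x xs)
  show ?case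
  proof (cases "sorted (x # xs)")
    case True
    then have "\<not> (Suc i < length (x # xs) \<and> (x # xs) ! i > (x # xs) ! Suc i)" for i
      by (meson leD sorted_iff_nth_Suc)
    then have "{k. k < length (x # xs) \<and> (\<forall>i. Suc i < length (x # xs) \<and> (x # xs) ! i > (x # xs) ! Suc i \<longrightarrow> i < k)}
      = {..<length (x # xs)}"
      by blast
    with True show ?thesis by simp
  next
    case False
    then obtain j where j: "Suc j < length (x # xs)" "(x # xs) ! j > (x # xs) ! Suc j"
      by (meson leI sorted_iff_nth_Suc)
    have "{k. k < length (x # xs) \<and> (\<forall>i. Suc i < length (x # xs) \<and> (x # xs) ! i > (x # xs) ! Suc i \<longrightarrow> i < k)}
      = Suc ` {k. k < length xs \<and> (\<forall>i. Suc i < length xs \<and> xs ! i > xs ! Suc i \<longrightarrow> i < k)}"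
      (is "?A = Suc ` ?B")
    proof (rule set_eqI)
      fix k show "k \<in> ?A \<longleftrightarrow> k \<in> Suc ` ?B"
      proof (cases k)
        case 0
        then show ?thesis using j by auto
      next
        case (Suc k')
        have "(\<forall>i. Suc i < length (x # xs) \<and> (x # xs) ! i > (x # xs) ! Suc i \<longrightarrow> i < Suc k')
          \<longleftrightarrow> (\<forall>i. Suc i < length xs \<and> xs ! i > xs ! Suc i \<longrightarrow> i < k')" (is "?P \<longleftrightarrow> ?Q")
        proof
          assume P: ?P
          show ?Q using P[rule_format, of "Suc i" for i] by auto
        next
          assume Q: ?Q
          show ?P
          proof (intro allI impI)
            fix i assume "Suc i < length (x # xs) \<and> (x # xs) ! i > (x # xs) ! Suc i"
            then show "i < Suc k'" using Q by (cases i) auto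
          qed
        qed
        then show ?thesis using Suc by auto
      qed
    qed
    then have "card ?A = card (Suc ` ?B)" by (simp only:)
    also have "\<dots> = card ?B" by (simp add: card_image)
    also have "\<dots> = runlen xs" by (rule Cons.IH)
    also have "\<dots> = runlen (x # xs)" using False by (simp only: runlen.simps if_False)
    finally show ?thesis .
  qed
qed simp

lemma sorted_imp_av321: "sorted xs \<Longrightarrow> av321 xs"
  by (induction xs) (auto intro: sorted_wrt_filter)

lemma sorted_imp_invs: "sorted xs \<Longrightarrow> invs xs = 0"
  by (induction xs) (auto simp: filter_empty_conv)

lemma invs_append:
  "invs (xs @ ys) = invs xs + invs ys + (\<Sum>x\<leftarrow>xs. length (filter (\<lambda>y. y < x) ys))"
  by (induction xs) auto

text \<open>As the maximum, \<open>n\<close> is inverted with every letter behind it and with none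
  in front.\<close>

lemma invs_insert_max:
  "\<lbrakk>\<And>y. y \<in> set (p @ s) \<Longrightarrow> y < n\<rbrakk> \<Longrightarrow> invs (p @ n # s) = invs (p @ s) + length s"
proof (induction p)
  case Nil
  then have "filter (\<lambda>y. y < n) s = s" by (auto simp: filter_id_conv)
  then show ?case by simp
next
  case (Cons a p)
  then have "a < n" by simp
  then show ?case using Cons by (auto simp: not_less_iff_gr_or_eq)
qed

text \<open>The maximum can only be the first letter of a 321 pattern, and it is one exactly when
  \<open>s\<close> contains an inversion.\<close>

lemma av321_insert_max:
  "\<lbrakk>\<And>y. y \<in> set (p @ s) \<Longrightarrow> y < n\<rbrakk> \<Longrightarrow> av321 (p @ n # s) \<longleftrightarrow> av321 (p @ s) \<and> sorted s"
proof (induction p)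
  case Nil
  then have "filter (\<lambda>y. y < n) s = s" by (auto simp: filter_id_conv)
  then show ?case using sorted_imp_av321 by auto
next
  case (Cons a p)
  then have "\<not> n < a" by (auto dest: order.asym)
  then show ?case using Cons by auto
qed

text \<open>The letters of \<open>ys\<close> take part in no inversion, hence in no 321 pattern. The
  R-letters will play the role of \<open>ys\<close>.\<close>

lemma av321_append_sorted_large:
  "\<lbrakk>sorted ys; \<And>x y. x \<in> set xs \<Longrightarrow> y \<in> set ys \<Longrightarrow> x < y\<rbrakk> \<Longrightarrow> av321 (xs @ ys) \<longleftrightarrow> av321 xs"
proof (induction xs)
  case (Cons a xs)
  then have "filter (\<lambda>y. y < a) ys = []" by (auto simp: filter_empty_conv dest: order.asym)
  then show ?case using Cons by simp
qed (simp add: sorted_imp_av321)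

lemma invs_append_sorted_large:
  "\<lbrakk>sorted ys; \<And>x y. x \<in> set xs \<Longrightarrow> y \<in> set ys \<Longrightarrow> x < y\<rbrakk> \<Longrightarrow> invs (xs @ ys) = invs xs"
proof (induction xs)
  case (Cons a xs)
  then have "filter (\<lambda>y. y < a) ys = []" by (auto simp: filter_empty_conv dest: order.asym)
  then show ?case using Cons by simp
qed (simp add: sorted_imp_invs)

lemma des_append_sorted:
  "sorted ys \<Longrightarrow> des (xs @ ys) = des xs + (if xs \<noteq> [] \<and> ys \<noteq> [] \<and> hd ys < last xs then 1 else 0)"
proof (induction xs rule: des.induct)
  case ("2_2" x)
  then show ?case using des_0_iff[of ys] by (cases ys) auto
qed (auto simp: des_0_iff)

lemma des_snoc_max: "(\<And>y. y \<in> set xs \<Longrightarrow> y < n) \<Longrightarrow> des (xs @ [n]) = des xs"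
  using des_append_sorted[of "[n]" xs] last_in_set[of xs] by (force dest: order.asym)

text \<open>A descent at the junction of \<open>xs\<close> and \<open>ys\<close> is broken up by
  \<open>n\<close>, which is itself the top of a new descent unless it comes last.\<close>

lemma des_insert_max:
  assumes "\<And>y. y \<in> set (xs @ ys) \<Longrightarrow> y < n" and "sorted ys"
  shows "des (xs @ n # ys) = des xs + (if ys = [] then 0 else 1)"
proof -
  have "des ((xs @ [n]) @ ys) = des (xs @ [n]) + (if ys = [] then 0 else 1)"
    unfolding des_append_sorted[OF assms(2)] using assms(1) hd_in_set[of ys] by auto
  also have "des (xs @ [n]) = des xs" using assms(1) by (intro des_snoc_max) auto
  finally show ?thesis by simp
qed

lemma runlen_append_descent:
  assumes "sorted ys" "ys \<noteq> []" "xs \<noteq> []" "hd ys < last xs"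
  shows "runlen (xs @ ys) = length ys"
  using assms(3,4)
proof (induction xs)
  case (Cons a xs)
  have "hd ys \<in> set ys" using assms(2) by simp
  have r: "runlen ys = length ys" using assms(1) by (cases ys) auto
  have ns: "\<not> sorted (a # xs @ ys)"
  proof
    assume "sorted (a # xs @ ys)"
    then have "last (a # xs) \<le> hd ys"
      using last_in_set[of "a # xs"] \<open>hd ys \<in> set ys\<close>
      by (metis append_Cons list.distinct(1) sorted_append)
    with Cons.prems show False by simp
  qed
  show ?case
  proof (cases "xs = []")
    case True
    with ns r show ?thesis by simp
  next
    case False
    with Cons.prems have "hd ys < last xs" by simp
    with Cons.IH False ns show ?thesis by simp
  qed
qed simp

lemma runlen_snoc_max:
  "(\<And>y. y \<in> set xs \<Longrightarrow> y < n) \<Longrightarrow> runlen (xs @ [n]) = Suc (runlen xs)"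
proof (induction xs)
  case (Cons a xs)
  have "sorted (a # xs @ [n]) \<longleftrightarrow> sorted (a # xs)"
    using Cons.prems by (auto simp: sorted_append less_imp_le)
  with Cons show ?case by simp
qed simp

text \<open>Isolates the last descent, from \<open>b\<close> down to \<open>a\<close>; then
  \<open>a # t\<close> is the last run.\<close>

lemma not_sorted_decomp:
  "\<not> sorted xs \<Longrightarrow> \<exists>ps b a t. xs = ps @ b # a # t \<and> a < b \<and> sorted (a # t)"
proof (induction xs)
  case (Cons x xs)
  show ?case
  proof (cases "sorted xs")
    case True
    with Cons.prems obtain a t where "xs = a # t" by (cases xs) auto
    with Cons.prems True have "a < x" by (auto dest: order_trans)
    with True \<open>xs = a # t\<close> show ?thesis by (intro exI[of _ "[]"] exI[of _ x] exI[of _ a] exI[of _ t]) auto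
  next
    case False
    with Cons.IH obtain ps b a t where "xs = ps @ b # a # t \<and> a < b \<and> sorted (a # t)" by blast
    then show ?thesis by (intro exI[of _ "x # ps"] exI) auto
  qed
qed simp


section \<open>Deleting the R-letters\<close>

text \<open>The words that remain when the R-letters are deleted, before any condition on descents
  is imposed; their M-letters are the letters above \<open>L\<close>.\<close>

definition LM_words :: "nat \<Rightarrow> nat \<Rightarrow> nat list set" where
  "LM_words L M =
     {u \<in> permutations_of_set {1..L + M}. av321 u \<and> sorted (filter (\<lambda>y. y \<le> L) u)}"

lemma finite_LM_words [simp]: "finite (LM_words L M)"
  by (simp add: LM_words_def)

text \<open>A property that persists to the right cuts the word in two; it will be the property of
  being an R-letter.\<close>

lemma filter_append_partition:
  assumes "\<And>i j. i < j \<Longrightarrow> j < length w \<Longrightarrow> P (w ! i) \<Longrightarrow> P (w ! j)"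
  shows "w = filter (\<lambda>y. \<not> P y) w @ filter P w"
  using assms
proof (induction w)
  case (Cons x w)
  have IH: "w = filter (\<lambda>y. \<not> P y) w @ filter P w"
    using Cons.prems[of "Suc i" "Suc j" for i j] by (intro Cons.IH) auto
  show ?case
  proof (cases "P x")
    case True
    then have "P y" if "y \<in> set w" for y
      using that Cons.prems[of 0 "Suc j" for j] by (auto simp: in_set_conv_nth)
    then have "filter (\<lambda>y. \<not> P y) w = []" "filter P w = w"
      by (auto simp: filter_empty_conv filter_id_conv)
    with True show ?thesis by simp
  next
    case False
    with IH show ?thesis by simp
  qed
qed simp

lemma map_nth_M_positions: "map ((!) w) (M_positions L M w) = filter (M_letter L M) w"
proof -
  have "filter (M_letter L M) (map ((!) w) [0..<length w]) = map ((!) w) (M_positions L M w)"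
    unfolding filter_map M_positions_def comp_def ..
  then show ?thesis by (simp add: map_nth)
qed

lemma length_M_positions: "length (M_positions L M w) = length (filter (M_letter L M) w)"
  unfolding map_nth_M_positions[symmetric] by simp

lemma nth_M_positions:
  "k < length (M_positions L M w) \<Longrightarrow> w ! (M_positions L M w ! k) = filter (M_letter L M) w ! k"
  unfolding map_nth_M_positions[symmetric] by simp

lemma M_descents_eq:
  "M_descents L M w =
    (let xs = filter (M_letter L M) w in {i. Suc i < length xs \<and> xs ! i > xs ! Suc i})"
  using nth_M_positions[of _ L M w] length_M_positions[of L M w]
  by (auto simp: M_descents_def Let_def)

text \<open>Here all R-letters stand at the end in increasing order, and every statistic of
  \<open>w\<close> is translated into one of \<open>u\<close> alone.\<close>

locale LMR_split =
  fixes L M R :: nat and u w :: "nat list"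
  assumes u: "u \<in> permutations_of_set {1..L + M}"
    and w: "w = u @ [L + M + 1..<L + M + R + 1]"
begin

lemma set_u: "set u = {1..L + M}" and distinct_u: "distinct u"
  using u by (auto simp: permutations_of_set_def)

lemma filter_M: "filter (M_letter L M) w = filter (\<lambda>y. L < y) u"
proof -
  have "filter (M_letter L M) u = filter (\<lambda>y. L < y) u"
    using set_u by (intro filter_cong) (auto simp: M_letter_def)
  moreover have "filter (M_letter L M) [L + M + 1..<L + M + R + 1] = []"
    by (auto simp: filter_empty_conv M_letter_def)
  ultimately show ?thesis by (simp add: w)
qed

lemma filter_L: "filter (L_letter L) w = filter (\<lambda>y. y \<le> L) u"
proof -
  have "filter (L_letter L) u = filter (\<lambda>y. y \<le> L) u"
    using set_u by (intro filter_cong) (auto simp: L_letter_def)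
  moreover have "filter (L_letter L) [L + M + 1..<L + M + R + 1] = []"
    by (auto simp: filter_empty_conv L_letter_def)
  ultimately show ?thesis by (simp add: w)
qed

lemma filter_R: "filter (R_letter L M R) w = [L + M + 1..<L + M + R + 1]"
proof -
  have "filter (R_letter L M R) u = []"
    using set_u by (auto simp: filter_empty_conv R_letter_def)
  moreover have "filter (R_letter L M R) [L + M + 1..<L + M + R + 1] = [L + M + 1..<L + M + R + 1]"
    by (auto simp: filter_id_conv R_letter_def)
  ultimately show ?thesis unfolding w by (simp only: filter_append append_Nil)
qed

lemma M_descents_w: "card (M_descents L M w) = des (filter (\<lambda>y. L < y) u)"
  by (simp add: M_descents_eq filter_M Let_def des_eq_card)

lemma R_letter_nth: "j < length w \<Longrightarrow> R_letter L M R (w ! j) \<longleftrightarrow> length u \<le> j"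
  using set_u nth_mem[of j u] by (auto simp: w nth_append R_letter_def simp del: upt_Suc)

lemma not_R_letter_nth: "j < length w \<Longrightarrow> L_letter L (w ! j) \<or> M_letter L M (w ! j) \<longleftrightarrow> j < length u"
  using set_u nth_mem[of j u]
  by (auto simp: w nth_append M_letter_def L_letter_def simp del: upt_Suc)

lemma alpha_w: "alpha L M R w = runlen (filter (\<lambda>y. L < y) u)"
proof -
  let ?xs = "filter (\<lambda>y. L < y) u" and ?ps = "M_positions L M w"
  \<comment> \<open>Every M-letter lies inside \<open>u\<close> and every R-letter behind it, so the
    third condition in \<open>alpha\<close> always holds.\<close>
  have "?ps ! k < j" if "k < length ?ps" "j < length w" "R_letter L M R (w ! j)" for k j
  proof -
    from that(1) have "?ps ! k \<in> set ?ps" by simp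
    then have "?ps ! k < length w" "M_letter L M (w ! (?ps ! k))"
      by (auto simp: M_positions_def)
    then have "?ps ! k < length u" using not_R_letter_nth by blast
    with R_letter_nth[OF that(2)] that(3) show ?thesis by simp
  qed
  then have "alpha L M R w = card {k. k < length ?ps \<and> (\<forall>i\<in>M_descents L M w. i < k)}"
    unfolding alpha_def Let_def by (intro arg_cong[where f = card]) blast
  also have "\<dots> = card {k. k < length ?xs \<and> (\<forall>i. Suc i < length ?xs \<and> ?xs ! i > ?xs ! Suc i \<longrightarrow> i < k)}"
    by (simp add: M_descents_eq length_M_positions filter_M Let_def)
  finally show ?thesis by (simp only: runlen_eq_card)
qed

lemma inv_count_w: "inv_count w = invs u"
  unfolding inv_count_eq w using set_u by (intro invs_append_sorted_large) (auto simp del: upt_Suc)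

lemma avoids_321_w: "avoids_321 w \<longleftrightarrow> av321 u"
  unfolding avoids_321_eq w using set_u by (intro av321_append_sorted_large) (auto simp del: upt_Suc)

lemma w_in_F0_words: "w \<in> F0_words L M R \<longleftrightarrow> u \<in> LM_words L M \<and> 2 \<le> des (filter (\<lambda>y. L < y) u)"
proof -
  have "distinct w" "set w = {1..L + M + R}"
    using set_u distinct_u by (auto simp: w)
  then have "w \<in> permutations_of_set {1..L + M + R}"
    by (simp add: permutations_of_set_def)
  moreover have "sorted_wrt (<) (filter (L_letter L) w) \<longleftrightarrow> sorted (filter (\<lambda>y. y \<le> L) u)"
    using distinct_u by (simp add: filter_L strict_sorted_iff)
  moreover have "\<forall>i<length w. \<forall>j<length w. L_letter L (w ! i) \<and> R_letter L M R (w ! j) \<longrightarrow> i < j"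
    using R_letter_nth not_R_letter_nth by (meson less_le_trans)
  moreover have "\<not> (\<exists>i j. i < j \<and> j < length w \<and> R_letter L M R (w ! i) \<and> M_letter L M (w ! j))"
    using R_letter_nth not_R_letter_nth by (meson less_le_trans less_trans not_less)
  ultimately show ?thesis
    unfolding F0_words_def LMR_words_def LM_words_def
    using u avoids_321_w M_descents_w filter_R by (simp del: upt_Suc)
qed

end

text \<open>A letter behind an R-letter is not an L-letter by the order condition in
  \<open>LMR_words\<close>, and not an M-letter by the choice of \<open>F0_words\<close>. So the
  R-letters form a suffix.\<close>

lemma F0_words_split:
  assumes "w \<in> F0_words L M R"
  obtains u where "LMR_split L M R u w"
proof
  let ?R = "R_letter L M R"
  let ?u = "filter (\<lambda>y. \<not> ?R y) w"
  have d: "distinct w" and s: "set w = {1..L + M + R}"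
    and str: "sorted_wrt (<) (filter ?R w)"
    and LR: "\<And>i j. i < length w \<Longrightarrow> j < length w \<Longrightarrow> L_letter L (w ! i) \<Longrightarrow> ?R (w ! j) \<Longrightarrow> i < j"
    and RM: "\<And>i j. i < j \<Longrightarrow> j < length w \<Longrightarrow> ?R (w ! i) \<Longrightarrow> \<not> M_letter L M (w ! j)"
    using assms by (auto simp: F0_words_def LMR_words_def permutations_of_set_def)
  have "?R (w ! j)" if "i < j" "j < length w" "?R (w ! i)" for i j
  proof -
    have "w ! j \<in> {1..L + M + R}" using that(2) s nth_mem by blast
    then have "L_letter L (w ! j) \<or> M_letter L M (w ! j) \<or> ?R (w ! j)"
      by (auto simp: L_letter_def M_letter_def R_letter_def)
    with that LR[of j i] RM[of i j] show ?thesis by auto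
  qed
  then have "w = ?u @ filter ?R w" by (rule filter_append_partition)
  moreover have "filter ?R w = [L + M + 1..<L + M + R + 1]"
    using str s by (intro strict_sorted_equal) (auto simp: R_letter_def simp del: upt_Suc)
  ultimately have "w = ?u @ [L + M + 1..<L + M + R + 1]" by simp
  moreover have "?u \<in> permutations_of_set {1..L + M}"
    using d s by (auto simp: permutations_of_set_def R_letter_def)
  ultimately show "LMR_split L M R ?u w" by unfold_locales
qed

text \<open>Appending the R-letters is a weight-preserving bijection, so \<open>R\<close> disappears
  from the sum.\<close>

lemma sum_F0_words:
  "(\<Sum>w\<in>F0_words L M R. q ^ inv_count w * r ^ alpha L M R w) =
   (\<Sum>u | u \<in> LM_words L M \<and> 2 \<le> des (filter (\<lambda>y. L < y) u).
      q ^ invs u * r ^ runlen (filter (\<lambda>y. L < y) u))" (is "_ = sum _ ?U")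
proof (rule sum.reindex_bij_betw[symmetric, THEN trans])
  let ?f = "\<lambda>u. u @ [L + M + 1..<L + M + R + 1]"
  have split: "LMR_split L M R u (?f u)" if "u \<in> LM_words L M" for u
    using that by unfold_locales (auto simp: LM_words_def)
  show "bij_betw ?f ?U (F0_words L M R)"
    unfolding bij_betw_def
  proof (intro conjI)
    show "?f ` ?U = F0_words L M R"
    proof (intro equalityI subsetI)
      fix w assume "w \<in> ?f ` ?U"
      then show "w \<in> F0_words L M R" using split LMR_split.w_in_F0_words by blast
    next
      fix w assume w: "w \<in> F0_words L M R"
      then obtain u where "LMR_split L M R u w" by (rule F0_words_split)
      with w show "w \<in> ?f ` ?U" using LMR_split.w_in_F0_words LMR_split.w by blast
    qed
  qed (simp add: inj_on_def)
  show "(\<Sum>u\<in>?U. q ^ inv_count (?f u) * r ^ alpha L M R (?f u)) =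
      (\<Sum>u\<in>?U. q ^ invs u * r ^ runlen (filter (\<lambda>y. L < y) u))"
    by (rule sum.cong[OF refl])
      (auto simp only: mem_Collect_eq LMR_split.inv_count_w[OF split] LMR_split.alpha_w[OF split])
qed


section \<open>Inserting the largest letter\<close>

text \<open>An inversion \<open>x\<close>, \<open>a\<close> among the letters of \<open>p\<close>
  above \<open>L\<close>, followed by some \<open>y \<le> L\<close>, would be a 321 pattern.\<close>

lemma av321_no_small_after_descent:
  "\<lbrakk>av321 (p @ s); \<not> sorted (filter (\<lambda>y. L < y) p); y \<in> set s\<rbrakk> \<Longrightarrow> L < y"
proof (induction p)
  case (Cons x p)
  show ?case
  proof (cases "sorted (filter (\<lambda>y. L < y) p)")
    case True
    with Cons.prems(2) obtain a where a: "a \<in> set p" "L < a" "a < x"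
      by (auto split: if_splits simp: not_le)
    show ?thesis
    proof (cases "y < x")
      case True
      have "sorted (filter (\<lambda>z. z < x) p @ filter (\<lambda>z. z < x) s)"
        using Cons.prems(1) by simp
      then have "a \<le> y" using a True Cons.prems(3) by (auto simp: sorted_append)
      with a show ?thesis by simp
    next
      case False
      with a show ?thesis by simp
    qed
  qed (use Cons in auto)
qed simp

lemma filter_eq_appendD:
  "filter P u = xs @ ys \<Longrightarrow> \<exists>c z. u = c @ z \<and> filter P c = xs \<and> filter P z = ys"
proof (induction xs arbitrary: u)
  case Nil
  then show ?case by (intro exI[of _ "[]"] exI[of _ u]) simp
next
  case (Cons x xs)
  then obtain us vs where "u = us @ x # vs" "\<forall>y\<in>set us. \<not> P y" "P x" "filter P vs = xs @ ys"
    by (auto simp: filter_eq_Cons_iff)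
  moreover from this Cons.IH obtain c z where "vs = c @ z" "filter P c = xs" "filter P z = ys"
    by blast
  ultimately show ?case by (intro exI[of _ "us @ x # c"] exI[of _ z]) simp
qed

text \<open>Two splits of one word are nested. This compares an insertion point \<open>p @ s\<close>
  with the start \<open>c @ z\<close> of the last run.\<close>

lemma append_eq_append_leD:
  assumes "c @ z = p @ s" "length s \<le> length z"
  shows "\<exists>x. z = x @ s \<and> p = c @ x"
  using assms(1)[unfolded append_eq_append_conv2] assms(2) by auto

text \<open>The last run of the M-letters is a contiguous suffix of the whole word: no L-letter can
  follow the bottom of the last descent.\<close>

lemma last_run_decomp:
  fixes u :: "'a::linorder list"
  assumes "av321 u" "\<not> sorted (filter (\<lambda>y. L < y) u)"
  obtains c z where "u = c @ z" "sorted z" "z \<noteq> []" "\<And>y. y \<in> set z \<Longrightarrow> L < y"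
    "filter (\<lambda>y. L < y) c \<noteq> []" "hd z < last (filter (\<lambda>y. L < y) c)"
    "runlen (filter (\<lambda>y. L < y) u) = length z"
    "des (filter (\<lambda>y. L < y) u) = Suc (des (filter (\<lambda>y. L < y) c))"
proof -
  let ?m = "filter (\<lambda>y. L < y)"
  obtain ps b a t where d: "?m u = ps @ b # a # t" "a < b" "sorted (a # t)"
    using not_sorted_decomp[OF assms(2)] by blast
  then have "?m u = (ps @ [b]) @ a # t" by simp
  then obtain c z where u: "u = c @ z" and c: "?m c = ps @ [b]" and z: "?m z = a # t"
    using filter_eq_appendD by metis
  from z obtain z1 t' where z': "z = z1 @ a # t'" "\<forall>y\<in>set z1. \<not> L < y" "L < a" "t = ?m t'"
    unfolding filter_eq_Cons_iff by blast
  \<comment> \<open>L-letters standing just before the bottom \<open>a\<close> of the descent are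
    moved to the front part, so that the suffix starts at \<open>a\<close> itself.\<close>
  let ?c = "c @ z1"
  have mc: "?m ?c = ps @ [b]" using z'(2) c by (simp add: filter_empty_conv)
  have u': "u = ?c @ a # t'" using u z' by simp
  have "L < y" if "y \<in> set t'" for y
  proof (rule av321_no_small_after_descent)
    show "av321 ((?c @ [a]) @ t')" using assms(1) u' by simp
    have "?m (?c @ [a]) = ps @ [b, a]"
      unfolding filter_append[of _ ?c "[a]"] mc using z'(3) by simp
    then show "\<not> sorted (?m (?c @ [a]))" using d(2) by (auto simp: sorted_append simp del: filter_append)
  qed (use that in auto)
  then have big: "L < y" if "y \<in> set (a # t')" for y using that z'(3) by auto
  then have "t = t'" using z'(4) by (auto simp: filter_id_conv)
  with big have mz: "?m (a # t') = a # t'" by (auto simp: filter_id_conv)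
  show ?thesis
  proof (rule that[of ?c "a # t'"])
    have mu: "?m u = ?m ?c @ a # t'" using u' mz by (simp only: filter_append)
    show "runlen (?m u) = length (a # t')"
      unfolding mu using d \<open>t = t'\<close> mc by (intro runlen_append_descent) auto
    show "des (?m u) = Suc (des (?m ?c))"
      unfolding mu using d \<open>t = t'\<close> mc by (subst des_append_sorted) auto
  qed (use u' d \<open>t = t'\<close> big mc in auto)
qed

lemma des_append_ge: "sorted ys \<Longrightarrow> des xs \<le> des (xs @ ys)"
  by (simp add: des_append_sorted)

text \<open>
  In a 321-avoiding word nothing small follows the bottom of a descent.  Hence, if the letters
  above \<open>L\<close> have two descents, the increasing suffixes \<open>s\<close> in front of which the largest letter \<open>n\<close>
  can be inserted are exactly those inside the last run of these letters.
\<close>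

lemma split_ge2_iff:
  fixes u :: "'a::linorder list"
  assumes av: "av321 u" and u: "u = p @ s" and lt: "\<And>y. y \<in> set u \<Longrightarrow> y < n"
    and des: "2 \<le> des (filter (\<lambda>y. L < y) u)"
  shows "sorted s \<and> 2 \<le> des (filter (\<lambda>y. L < y) p @ n # filter (\<lambda>y. L < y) s)
    \<longleftrightarrow> length s \<le> runlen (filter (\<lambda>y. L < y) u)"
proof -
  let ?m = "filter (\<lambda>y. L < y)"
  have "\<not> sorted (?m u)" using des des_0_iff[of "?m u"] by simp
  then obtain c z where cz: "u = c @ z" "sorted z" "z \<noteq> []" "\<And>y. y \<in> set z \<Longrightarrow> L < y"
    "?m c \<noteq> []" "hd z < last (?m c)" "runlen (?m u) = length z" "des (?m u) = Suc (des (?m c))"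
    using last_run_decomp[OF av] by metis
  have ins: "des (?m p @ n # ?m s) = des (?m p) + (if ?m s = [] then 0 else 1)" if "sorted s"
    using that lt u by (intro des_insert_max) (auto intro: sorted_wrt_filter)
  show ?thesis
  proof (cases "length s \<le> length z")
    case True
    then obtain x where x: "z = x @ s" "p = c @ x"
      using append_eq_append_leD cz(1) u by metis
    have s: "sorted s" using cz(2) x by (simp add: sorted_append)
    have "?m s = s" "?m x = x" using cz(4) x by (auto simp: filter_id_conv)
    moreover have "des (?m c) \<le> des (?m p)"
      using \<open>?m x = x\<close> cz(2) x by (auto simp: sorted_append intro: des_append_ge)
    \<comment> \<open>If \<open>s\<close> is empty, \<open>p\<close> is all of \<open>u\<close> and
      keeps its descents. Otherwise \<open>p\<close> has at least the descents of \<open>c\<close>,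
      of which there is one, and \<open>n\<close> adds another.\<close>
    ultimately have "2 \<le> des (?m p @ n # ?m s)"
      using ins[OF s] des cz(8) u by auto
    with True s cz(7) show ?thesis by simp
  next
    case False
    then obtain y where y: "s = y @ z" "c = p @ y"
      using append_eq_append_leD cz(1) u nle_le by metis
    with False have "y \<noteq> []" by auto
    have "\<not> sorted s"
    proof
      assume s: "sorted s"
      show False
      proof (cases "?m y = []")
        case True
        \<comment> \<open>Now \<open>y\<close> consists of L-letters only, and \<open>p\<close> has
          all M-letters of \<open>c\<close>. Since \<open>u\<close> has two descents, one of them
          lies in \<open>p\<close>, so no L-letter may follow.\<close>
        then have "\<not> sorted (?m p)" using cz(8) des y(2) des_0_iff[of "?m p"] by auto
        then have "L < hd y"
          using av321_no_small_after_descent[of p s L "hd y"] av u y \<open>y \<noteq> []\<close> by simp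
        with True \<open>y \<noteq> []\<close> show False by (cases y) (auto split: if_splits)
      next
        case False
        \<comment> \<open>The top of the last descent lies in \<open>y\<close> and its bottom is the
          head of \<open>z\<close>, so \<open>s\<close> contains this descent.\<close>
        then have "last (?m c) \<in> set y" using y(2) last_in_set[OF False] by simp
        with s cz(3) have "last (?m c) \<le> hd z" using y(1) by (auto simp: sorted_append)
        with cz(6) show False by simp
      qed
    qed
    with False cz(7) show ?thesis by simp
  qed
qed

text \<open>Two descents arise only if the old one survives and \<open>n\<close> creates another.
  The old one survives when \<open>p\<close> reaches into the last run, and \<open>n\<close> creates
  one when \<open>s\<close> is nonempty. At \<open>length s = runlen ...\<close> the letter
  \<open>n\<close> sits inside the only descent and merely replaces it.\<close>

lemma split_eq1_iff:
  fixes u :: "'a::linorder list"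
  assumes av: "av321 u" and u: "u = p @ s" and lt: "\<And>y. y \<in> set u \<Longrightarrow> y < n"
    and des: "des (filter (\<lambda>y. L < y) u) = 1"
  shows "sorted s \<and> 2 \<le> des (filter (\<lambda>y. L < y) p @ n # filter (\<lambda>y. L < y) s)
    \<longleftrightarrow> 1 \<le> length s \<and> length s < runlen (filter (\<lambda>y. L < y) u)"
proof -
  let ?m = "filter (\<lambda>y. L < y)"
  have "\<not> sorted (?m u)" using des des_0_iff[of "?m u"] by simp
  then obtain c z where cz: "u = c @ z" "sorted z" "z \<noteq> []" "\<And>y. y \<in> set z \<Longrightarrow> L < y"
    "?m c \<noteq> []" "hd z < last (?m c)" "runlen (?m u) = length z" "des (?m u) = Suc (des (?m c))"
    using last_run_decomp[OF av] by metis
  have ins: "des (?m p @ n # ?m s) = des (?m p) + (if ?m s = [] then 0 else 1)" if "sorted s"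
    using that lt u by (intro des_insert_max) (auto intro: sorted_wrt_filter)
  have mc: "des (?m c) = 0" using des cz(8) by simp
  show ?thesis
  proof (cases "length s < length z")
    case True
    then obtain x where x: "z = x @ s" "p = c @ x"
      using append_eq_append_leD cz(1) u less_imp_le by metis
    with True have "x \<noteq> []" by auto
    have s: "sorted s" "sorted x" using cz(2) x by (simp_all add: sorted_append)
    have m: "?m s = s" "?m x = x" using cz(4) x by (auto simp: filter_id_conv)
    have "hd x < last (?m c)" using cz(6) x \<open>x \<noteq> []\<close> by simp
    then have "des (?m p) = 1"
      using m cz(5) x \<open>x \<noteq> []\<close> mc by (simp add: des_append_sorted[OF s(2)])
    with ins[OF s(1)] m True s cz(7) show ?thesis by (cases s) auto
  next
    case False
    then obtain y where y: "s = y @ z" "c = p @ y"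
      using append_eq_append_leD cz(1) u not_less by metis
    have "sorted (?m p)" using mc y(2) by (simp add: des_0_iff sorted_append)
    then have "\<not> (sorted s \<and> 2 \<le> des (?m p @ n # ?m s))"
      using ins des_0_iff[of "?m p"] by auto
    with False cz(7) show ?thesis by simp
  qed
qed

text \<open>One insertion creates at most one descent.\<close>

lemma split_eq0:
  fixes p s :: "'a::linorder list"
  assumes lt: "\<And>y. y \<in> set (p @ s) \<Longrightarrow> y < n" and "sorted s"
    and des: "des (filter (\<lambda>y. L < y) (p @ s)) = 0"
  shows "des (filter (\<lambda>y. L < y) p @ n # filter (\<lambda>y. L < y) s) < 2"
proof -
  let ?m = "filter (\<lambda>y. L < y)"
  have "des (?m p @ n # ?m s) = des (?m p) + (if ?m s = [] then 0 else 1)"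
    using assms by (intro des_insert_max) (auto intro: sorted_wrt_filter)
  moreover have "des (?m p) = 0" using des by (simp add: des_0_iff sorted_append)
  ultimately show ?thesis by simp
qed

text \<open>At the end of the word \<open>n\<close> extends the last run; anywhere else the descent
  from \<open>n\<close> to the head of \<open>s\<close> makes \<open>s\<close> the last run.\<close>

lemma runlen_split:
  fixes u :: "'a::linorder list"
  assumes av: "av321 u" and u: "u = p @ s" and lt: "\<And>y. y \<in> set u \<Longrightarrow> y < n"
    and des: "1 \<le> des (filter (\<lambda>y. L < y) u)"
    and le: "length s \<le> runlen (filter (\<lambda>y. L < y) u)"
  shows "runlen (filter (\<lambda>y. L < y) p @ n # filter (\<lambda>y. L < y) s)
    = (if s = [] then Suc (runlen (filter (\<lambda>y. L < y) u)) else length s)"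
proof -
  let ?m = "filter (\<lambda>y. L < y)"
  have "\<not> sorted (?m u)" using des des_0_iff[of "?m u"] by simp
  then obtain c z where cz: "u = c @ z" "sorted z" "\<And>y. y \<in> set z \<Longrightarrow> L < y"
    "runlen (?m u) = length z"
    using last_run_decomp[OF av] by metis
  then obtain x where x: "z = x @ s" "p = c @ x"
    using append_eq_append_leD le u by metis
  have s: "sorted s" using cz(2) x by (simp add: sorted_append)
  have m: "?m s = s" using cz(3) x by (auto simp: filter_id_conv)
  show ?thesis
  proof (cases "s = []")
    case True
    then have "runlen (?m p @ [n]) = Suc (runlen (?m p))"
      using u lt by (intro runlen_snoc_max) auto
    then show ?thesis using True u by simp
  next
    case False
    have "runlen ((?m p @ [n]) @ s) = length s"
      using s False lt u by (intro runlen_append_descent) auto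
    with False m show ?thesis by simp
  qed
qed

text \<open>The new letter exceeds \<open>L\<close>, so the order of the L-letters is unaffected;
  only 321-avoidance restricts the place of insertion.\<close>

lemma LM_words_insert_max_iff:
  assumes "\<And>y. y \<in> set (p @ s) \<Longrightarrow> y \<noteq> Suc (L + M)"
  shows "p @ Suc (L + M) # s \<in> LM_words L (Suc M) \<longleftrightarrow> p @ s \<in> LM_words L M \<and> sorted s"
proof -
  have perm: "p @ Suc (L + M) # s \<in> permutations_of_set {1..L + Suc M} \<longleftrightarrow>
      p @ s \<in> permutations_of_set {1..L + M}" (is "?A \<longleftrightarrow> ?B")
  proof -
    have "insert (Suc (L + M)) (set (p @ s)) = {1..L + Suc M} \<longleftrightarrow> set (p @ s) = {1..L + M}"
      (is "insert ?n ?S = ?T \<longleftrightarrow> ?S = ?U")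
    proof -
      have "?n \<notin> ?S" using assms by blast
      moreover have "?n \<notin> ?U" "?T = insert ?n ?U" by auto
      ultimately show ?thesis by (metis insert_ident)
    qed
    then show ?thesis using assms by (auto simp: permutations_of_set_def)
  qed
  show ?thesis
  proof (cases ?B)
    case True
    then have "set (p @ s) = {1..L + M}" by (simp add: permutations_of_set_def)
    then have "av321 (p @ Suc (L + M) # s) \<longleftrightarrow> av321 (p @ s) \<and> sorted s"
      by (intro av321_insert_max) (auto simp del: set_append)
    with perm show ?thesis by (auto simp: LM_words_def)
  next
    case False
    with perm show ?thesis by (auto simp: LM_words_def)
  qed
qed

lemma finite_splits: "finite {(p, s). u = p @ s \<and> P p s}"
proof (rule finite_subset)
  show "{(p, s). u = p @ s \<and> P p s} \<subseteq> (\<lambda>k. (take k u, drop k u)) ` {..length u}"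
  proof clarify
    fix p s
    show "(p, s) \<in> (\<lambda>k. (take k (p @ s), drop k (p @ s))) ` {..length (p @ s)}"
      by (rule image_eqI[of _ _ "length p"]) auto
  qed
qed simp

text \<open>Deleting the largest letter is inverse to inserting it in front of an increasing
  suffix.\<close>

lemma sum_LM_words_Suc:
  fixes F :: "nat list \<Rightarrow> 'a::comm_monoid_add"
  shows "(\<Sum>u\<in>LM_words L (Suc M). F u) =
    (\<Sum>u\<in>LM_words L M. \<Sum>(p, s)\<in>{(p, s). u = p @ s \<and> sorted s}. F (p @ Suc (L + M) # s))"
proof -
  let ?n = "Suc (L + M)"
  let ?S = "\<lambda>u. {(p, s). u = p @ s \<and> sorted s}"
  have notin: "Suc (L + M) \<notin> set u" if "u \<in> LM_words L M" for u
    using that by (auto simp: LM_words_def permutations_of_set_def)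
  let ?I = "Sigma (LM_words L M) ?S"
  have "bij_betw (\<lambda>(u, p, s). p @ ?n # s) ?I (LM_words L (Suc M))"
    unfolding bij_betw_def
  proof (intro conjI)
    show "inj_on (\<lambda>(u, p, s). p @ ?n # s) ?I"
      by (rule inj_onI) (auto dest!: notin simp: append_Cons_eq_iff)
    show "(\<lambda>(u, p, s). p @ ?n # s) ` ?I = LM_words L (Suc M)"
    proof (intro equalityI subsetI)
      fix w assume "w \<in> (\<lambda>(u, p, s). p @ ?n # s) ` ?I"
      then obtain p s where "w = p @ ?n # s" "p @ s \<in> LM_words L M" "sorted s" by auto
      with notin[of "p @ s"] LM_words_insert_max_iff[of p s L M] show "w \<in> LM_words L (Suc M)"
        by auto
    next
      fix w assume w: "w \<in> LM_words L (Suc M)"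
      then have "?n \<in> set w" "distinct w" by (auto simp: LM_words_def permutations_of_set_def)
      then obtain p s where ps: "w = p @ ?n # s" "?n \<notin> set (p @ s)"
        by (auto simp: in_set_conv_decomp)
      with w have "p @ s \<in> LM_words L M \<and> sorted s"
        using LM_words_insert_max_iff[of p s L M] by auto
      with ps show "w \<in> (\<lambda>(u, p, s). p @ ?n # s) ` ?I" by (auto simp: image_iff)
    qed
  qed
  then have "(\<Sum>u\<in>LM_words L (Suc M). F u) = (\<Sum>(u, p, s)\<in>?I. F (p @ ?n # s))"
    by (subst sum.reindex_bij_betw[symmetric]) (auto simp: case_prod_unfold)
  also have "\<dots> = (\<Sum>u\<in>LM_words L M. \<Sum>(p, s)\<in>?S u. F (p @ ?n # s))"
    using finite_splits by (subst sum.Sigma) (auto simp: case_prod_unfold)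
  finally show ?thesis .
qed

text \<open>A split of \<open>u\<close> is determined by the length of its suffix, which becomes the
  summation index.\<close>

lemma sum_splits:
  assumes "\<And>p s. u = p @ s \<Longrightarrow> P p s \<longleftrightarrow> length s \<in> K" and "K \<subseteq> {..length u}"
    and "\<And>p s. u = p @ s \<Longrightarrow> P p s \<Longrightarrow> F p s = g (length s)"
  shows "(\<Sum>(p, s)\<in>{(p, s). u = p @ s \<and> P p s}. F p s) = (\<Sum>k\<in>K. g k)"
proof (rule sum.reindex_bij_witness[where j = "\<lambda>(p, s). length s"
        and i = "\<lambda>k. (take (length u - k) u, drop (length u - k) u)"])
  fix k assume "k \<in> K"
  then have "k \<le> length u" using assms(2) by auto
  then show "(case (take (length u - k) u, drop (length u - k) u) of (p, s) \<Rightarrow> length s) = k" by simp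
  show "(take (length u - k) u, drop (length u - k) u) \<in> {(p, s). u = p @ s \<and> P p s}"
    using assms(1)[of "take (length u - k) u" "drop (length u - k) u"] \<open>k \<in> K\<close> \<open>k \<le> length u\<close> by simp
qed (use assms in auto)

lemma runlen_le_length: "runlen xs \<le> length xs"
  by (induction xs) auto

lemma runlen_filter_le: "runlen (filter P xs) \<le> length xs"
  by (rule order_trans[OF runlen_le_length length_filter_le])

text \<open>The recursion on coefficients: all insertions into one word \<open>u\<close> are summed
  according to whether it has at least two, one or no descents.\<close>

lemma sum_two_descents_Suc:
  fixes q r :: "'a::comm_ring_1"
  defines "m \<equiv> \<lambda>L. filter (\<lambda>y::nat. L < y)"
  shows "(\<Sum>u | u \<in> LM_words L (Suc M) \<and> 2 \<le> des (m L u). q ^ invs u * r ^ runlen (m L u)) =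
    (\<Sum>u | u \<in> LM_words L M \<and> 2 \<le> des (m L u).
      q ^ invs u * (r ^ Suc (runlen (m L u)) + (\<Sum>k\<in>{1..runlen (m L u)}. (q * r) ^ k))) +
    (\<Sum>u | u \<in> LM_words L M \<and> des (m L u) = 1.
      q ^ invs u * (\<Sum>k\<in>{1..<runlen (m L u)}. (q * r) ^ k))"
proof -
  let ?n = "Suc (L + M)"
  \<comment> \<open>Extending the weight by zero moves the descent condition into the summand, so
    that the sum over all of \<open>LM_words L (Suc M)\<close> can be rewritten by deletion.\<close>
  define F where "F u = (if 2 \<le> des (m L u) then q ^ invs u * r ^ runlen (m L u) else 0)" for u
  define h where "h u =
    (if 2 \<le> des (m L u) then q ^ invs u * (r ^ Suc (runlen (m L u)) + (\<Sum>k\<in>{1..runlen (m L u)}. (q * r) ^ k))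
     else 0) +
    (if des (m L u) = 1 then q ^ invs u * (\<Sum>k\<in>{1..<runlen (m L u)}. (q * r) ^ k) else 0)" for u
  have "(\<Sum>(p, s)\<in>{(p, s). u = p @ s \<and> sorted s}. F (p @ ?n # s)) = h u" if "u \<in> LM_words L M" for u
  proof -
    have av: "av321 u" and lt: "\<And>y. y \<in> set u \<Longrightarrow> y < ?n"
      using that by (auto simp: LM_words_def permutations_of_set_def)
    have ms: "m L (p @ ?n # s) = m L p @ ?n # m L s" for p s by (simp add: m_def)
    let ?P = "\<lambda>p s. sorted s \<and> 2 \<le> des (m L p @ ?n # m L s)"
    let ?F = "\<lambda>p s. q ^ invs (p @ ?n # s) * r ^ runlen (m L p @ ?n # m L s)"
    have "(\<Sum>(p, s)\<in>{(p, s). u = p @ s \<and> sorted s}. F (p @ ?n # s)) =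
      (\<Sum>(p, s)\<in>{(p, s). u = p @ s \<and> ?P p s}. ?F p s)"
      using finite_splits by (intro sum.mono_neutral_cong_right) (auto simp: F_def ms split: if_splits)
    also have "\<dots> = h u"
    proof -
      have inv: "invs (p @ ?n # s) = invs u + length s" if "u = p @ s" for p s
        using lt that by (subst invs_insert_max) auto
      consider "2 \<le> des (m L u)" | "des (m L u) = 1" | "des (m L u) = 0" by linarith
      then show ?thesis
      proof cases
        case 1
        have "(\<Sum>(p, s)\<in>{(p, s). u = p @ s \<and> ?P p s}. ?F p s) =
          (\<Sum>k\<in>{0..runlen (m L u)}. q ^ invs u * q ^ k * r ^ (if k = 0 then Suc (runlen (m L u)) else k))"
        proof (rule sum_splits)
          fix p s assume ps: "u = p @ s"
          show iff: "?P p s \<longleftrightarrow> length s \<in> {0..runlen (m L u)}"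
            using split_ge2_iff[OF av ps lt] 1 by (simp add: m_def)
          assume "?P p s"
          with iff have "runlen (m L p @ ?n # m L s) = (if s = [] then Suc (runlen (m L u)) else length s)"
            unfolding m_def using 1 by (intro runlen_split[OF av ps lt]) (auto simp: m_def)
          then show "?F p s = q ^ invs u * q ^ length s *
              r ^ (if length s = 0 then Suc (runlen (m L u)) else length s)"
            using inv[OF ps] by (simp add: power_add)
        qed (auto simp: m_def intro: order_trans[OF _ runlen_filter_le])
        also have "\<dots> = q ^ invs u * r ^ Suc (runlen (m L u)) +
            (\<Sum>k\<in>{1..runlen (m L u)}. q ^ invs u * q ^ k * r ^ k)"
          by (subst sum.atLeast_Suc_atMost) auto
        finally show ?thesis
          using 1 by (simp add: h_def distrib_left sum_distrib_left power_mult_distrib mult.assoc)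
      next
        case 2
        have "(\<Sum>(p, s)\<in>{(p, s). u = p @ s \<and> ?P p s}. ?F p s) =
          (\<Sum>k\<in>{1..<runlen (m L u)}. q ^ invs u * q ^ k * r ^ k)"
        proof (rule sum_splits)
          fix p s assume ps: "u = p @ s"
          show iff: "?P p s \<longleftrightarrow> length s \<in> {1..<runlen (m L u)}"
            using split_eq1_iff[OF av ps lt] 2 by (simp add: m_def)
          assume "?P p s"
          with iff have "1 \<le> length s" "length s < runlen (m L u)" by auto
          then have "runlen (m L p @ ?n # m L s) = length s"
            using runlen_split[OF av ps lt, of L] 2 by (auto simp: m_def)
          then show "?F p s = q ^ invs u * q ^ length s * r ^ length s"
            using inv[OF ps] by (simp add: power_add)
        qed (auto simp: m_def intro: order_trans[OF less_imp_le runlen_filter_le])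
        then show ?thesis
          using 2 by (simp add: h_def sum_distrib_left power_mult_distrib mult.assoc)
      next
        case 3
        then have "{(p, s). u = p @ s \<and> ?P p s} = {}"
          using split_eq0[of _ _ ?n L] lt by (auto simp: m_def simp flip: not_less)
        then have "(\<Sum>(p, s)\<in>{(p, s). u = p @ s \<and> ?P p s}. ?F p s) = 0" by (simp only: sum.empty)
        with 3 show ?thesis by (simp add: h_def)
      qed
    qed
    finally show ?thesis .
  qed
  then have "(\<Sum>u\<in>LM_words L (Suc M). F u) = (\<Sum>u\<in>LM_words L M. h u)"
    unfolding sum_LM_words_Suc by (rule sum.cong[OF refl])
  then show ?thesis
    by (simp add: F_def h_def sum.distrib flip: sum.inter_filter)
qed


section \<open>Gaussian binomials as generating functions of shuffles and subsets\<close>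

lemma qbinom_0 [simp]: "qbinom n 0 q = 1"
  by (simp add: qbinom_def)

lemma qbinom_n_n:
  fixes q :: "'a::field"
  assumes "\<forall>n>0. q ^ n \<noteq> 1"
  shows "qbinom n n q = 1"
  using assms by (simp add: qbinom_def)

text \<open>The numerator contains the factor with \<open>j = n\<close>, which is
  \<open>1 - q ^ 0\<close>.\<close>

lemma qbinom_eq_0: "n < k \<Longrightarrow> qbinom n k q = 0"
  by (force simp: qbinom_def)

lemma qbinom_Suc_Suc_shift:
  fixes q :: "'a::field"
  shows "qbinom (Suc n) (Suc k) q = (1 - q ^ Suc n) / (1 - q ^ Suc k) * qbinom n k q"
  by (simp add: qbinom_def prod.lessThan_Suc_shift del: prod.lessThan_Suc power_Suc)

lemma qbinom_Suc_right:
  fixes q :: "'a::field"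
  shows "qbinom n (Suc k) q = (1 - q ^ (n - k)) / (1 - q ^ Suc k) * qbinom n k q"
proof -
  have "(\<Prod>j<Suc k. 1 - q ^ (Suc k - j)) = (1 - q ^ Suc k) * (\<Prod>j<k. 1 - q ^ (k - j))"
    by (simp add: prod.lessThan_Suc_shift del: prod.lessThan_Suc power_Suc)
  then show ?thesis by (simp add: qbinom_def mult.commute)
qed

lemma qbinom_pascal:
  fixes q :: "'a::field"
  assumes q: "\<forall>n>0. q ^ n \<noteq> 1" and "k \<le> n"
  shows "qbinom (Suc n) (Suc k) q = qbinom n (Suc k) q + q ^ (n - k) * qbinom n k q"
    and "qbinom (Suc n) (Suc k) q = qbinom n k q + q ^ Suc k * qbinom n (Suc k) q"
proof -
  have nz: "1 - q ^ Suc k \<noteq> 0" using q by (simp del: power_Suc)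
  \<comment> \<open>With this factorization both rules become identities in
    \<open>q ^ (n - k)\<close> and \<open>q ^ Suc k\<close>, multiplied by
    \<open>qbinom n k q\<close>.\<close>
  have p: "q ^ Suc n = q ^ (n - k) * q ^ Suc k"
    using assms(2) by (simp flip: power_add)
  show "qbinom (Suc n) (Suc k) q = qbinom n (Suc k) q + q ^ (n - k) * qbinom n k q"
    unfolding qbinom_Suc_Suc_shift[of n k] qbinom_Suc_right[of n k] p using nz
    by (simp add: field_simps del: power_Suc)
  show "qbinom (Suc n) (Suc k) q = qbinom n k q + q ^ Suc k * qbinom n (Suc k) q"
    unfolding qbinom_Suc_Suc_shift[of n k] qbinom_Suc_right[of n k] p using nz
    by (simp add: field_simps del: power_Suc)
qed

text \<open>Split by the first letter: \<open>x\<close> in front is smallest and adds no inversion,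
  while \<open>y\<close> in front is inverted with exactly the letters of \<open>x # xs\<close>.
  This is the second Pascal rule.\<close>

lemma sum_shuffles_invs:
  fixes q :: "'b::field" and xs ys :: "'a::linorder list"
  assumes q: "\<forall>n>0. q ^ n \<noteq> 1"
    and "sorted xs" "sorted ys" "\<And>x y. x \<in> set xs \<Longrightarrow> y \<in> set ys \<Longrightarrow> x < y"
  shows "(\<Sum>v\<in>shuffles xs ys. q ^ invs v) = qbinom (length xs + length ys) (length xs) q"
  using assms(2-4)
proof (induction xs ys rule: shuffles.induct)
  case (1 ys)
  then show ?case by (simp add: sorted_imp_invs)
next
  case (2 xs)
  then show ?case by (simp add: sorted_imp_invs qbinom_n_n[OF q])
next
  case (3 x xs y ys)
  \<comment> \<open>\<open>shuffles\<close> is a set, so the two cases must be disjoint for the sum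
    to split.\<close>
  have "x \<noteq> y" using "3.prems"(3)[of x y] by auto
  then have disj: "(#) x ` shuffles xs (y # ys) \<inter> (#) y ` shuffles (x # xs) ys = {}" by auto
  have x: "invs (x # v) = invs v" if "v \<in> shuffles xs (y # ys)" for v
  proof -
    have "set v = set xs \<union> set (y # ys)" using that by (rule set_shuffles)
    then have "filter (\<lambda>z. z < x) v = []"
      using "3.prems" by (force simp: filter_empty_conv not_less less_imp_le)
    then show ?thesis by simp
  qed
  have y: "invs (y # v) = length (x # xs) + invs v" if "v \<in> shuffles (x # xs) ys" for v
  proof -
    have "filter (\<lambda>z. z < y) (x # xs) = x # xs" "filter (\<lambda>z. z < y) ys = []"
      using "3.prems" by (auto simp: filter_empty_conv filter_id_conv not_less)
    then have "filter (\<lambda>z. z < y) v \<in> shuffles (x # xs) []"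
      using that filter_shuffles[of "\<lambda>z. z < y" "x # xs" ys] by auto
    then have "filter (\<lambda>z. z < y) v = x # xs" by (simp only: shuffles.simps singleton_iff)
    then show ?thesis by simp
  qed
  let ?n = "Suc (length xs + length ys)"
  have "(\<Sum>v\<in>shuffles (x # xs) (y # ys). q ^ invs v) =
      (\<Sum>v\<in>shuffles xs (y # ys). q ^ invs (x # v)) + (\<Sum>v\<in>shuffles (x # xs) ys. q ^ invs (y # v))"
    by (simp only: shuffles.simps, subst sum.union_disjoint[OF _ _ disj])
       (simp_all add: sum.reindex comp_def del: invs.simps)
  also have "(\<Sum>v\<in>shuffles xs (y # ys). q ^ invs (x # v)) = (\<Sum>v\<in>shuffles xs (y # ys). q ^ invs v)"
    using x by (intro sum.cong) auto
  also have "\<dots> = qbinom ?n (length xs) q"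
    using "3.IH"(1) "3.prems" by simp
  also have "(\<Sum>v\<in>shuffles (x # xs) ys. q ^ invs (y # v)) =
      q ^ length (x # xs) * (\<Sum>v\<in>shuffles (x # xs) ys. q ^ invs v)"
    unfolding sum_distrib_left using y by (intro sum.cong) (auto simp: power_add)
  also have "(\<Sum>v\<in>shuffles (x # xs) ys. q ^ invs v) = qbinom ?n (length (x # xs)) q"
    using "3.IH"(2) "3.prems" by simp
  also have "qbinom ?n (length xs) q + q ^ length (x # xs) * qbinom ?n (length (x # xs)) q =
      qbinom (Suc ?n) (Suc (length xs)) q"
    by (subst qbinom_pascal(2)[OF q]) auto
  finally show ?case by simp
qed

text \<open>The number of inversions between the letters of \<open>S\<close> and those of
  \<open>T\<close> when all of \<open>S\<close> is placed first.\<close>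

definition cross :: "nat set \<Rightarrow> nat set \<Rightarrow> nat" where
  "cross S T = (\<Sum>s\<in>S. card {t \<in> T. t < s})"

text \<open>Split by whether the largest element belongs to \<open>S\<close>; this is the first
  Pascal rule. The offset \<open>a\<close> allows the ground set to be the M-letters.\<close>

lemma sum_subsets_cross:
  fixes q :: "'b::field"
  assumes q: "\<forall>n>0. q ^ n \<noteq> 1"
  shows "(\<Sum>S | S \<subseteq> {a..<a + m} \<and> card S = i. q ^ cross S ({a..<a + m} - S)) = qbinom m i q"
proof (induction m arbitrary: i)
  case 0
  have "{S. S \<subseteq> {a..<a + 0} \<and> card S = i} = (if i = 0 then {{}} else {})" by auto
  then show ?case by (simp add: cross_def qbinom_eq_0 del: Collect_conj_eq)
next
  case (Suc m)
  let ?A = "{a..<a + m}" and ?B = "{a..<a + Suc m}" and ?n = "a + m"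
  have B: "?B = insert ?n ?A" by auto
  show ?case
  proof (cases i)
    case 0
    have "{S. S \<subseteq> ?B \<and> card S = 0} = {{}}"
      by (auto simp: card_eq_0_iff dest: finite_subset)
    with 0 show ?thesis by (simp add: cross_def)
  next
    case (Suc j)
    let ?P = "\<lambda>i. {S. S \<subseteq> ?A \<and> card S = i}"
    have nA: "?n \<notin> S" if "S \<subseteq> ?A" for S using that by auto
    have fin: "finite S" if "S \<subseteq> ?A" for S using that by (rule finite_subset) simp
    have eq: "{S. S \<subseteq> ?B \<and> card S = Suc j} = ?P (Suc j) \<union> insert ?n ` ?P j" (is "?X = ?Y")
    proof (intro equalityI subsetI)
      fix S assume S: "S \<in> ?X"
      show "S \<in> ?Y"
      proof (cases "?n \<in> S")
        case True
        with S have "S - {?n} \<in> ?P j" by (auto simp: B dest: finite_subset)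
        with True show ?thesis by (auto intro!: image_eqI[of _ _ "S - {?n}"])
      next
        case False
        with S have "S \<subseteq> ?A" unfolding B by blast
        with S show ?thesis by simp
      qed
    next
      fix S assume "S \<in> ?Y"
      then show "S \<in> ?X"
        using fin nA by (auto simp: B)
    qed
    \<comment> \<open>In the complement, the largest element lies below no element of
      \<open>S\<close> and is never counted.\<close>
    have c1: "cross S (?B - S) = cross S (?A - S)" if "S \<in> ?P k" for S k
      unfolding cross_def using that
      by (intro sum.cong arg_cong[where f = card]) (auto simp: B)
    \<comment> \<open>As a member of the subset, the largest element exceeds all
      \<open>m - j\<close> elements of the complement.\<close>
    have c2: "cross (insert ?n S) (?B - insert ?n S) = m - j + cross S (?A - S)" if "S \<in> ?P j" for S
    proof -
      have S: "finite S" "S \<subseteq> ?A" "card S = j" using that fin by auto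
      have d: "?B - insert ?n S = ?A - S" using S(2) by (auto simp: B)
      have "{t \<in> ?A - S. t < ?n} = ?A - S" by auto
      then have "card {t \<in> ?A - S. t < ?n} = m - j" using S by (simp add: card_Diff_subset)
      moreover have "?n \<notin> S" using S(2) by auto
      ultimately show ?thesis unfolding d unfolding cross_def using S(1) by simp
    qed
    have inj: "inj_on (insert ?n) (?P j)"
      using nA by (intro inj_onI) (metis (mono_tags, lifting) insert_ident mem_Collect_eq)
    have "(\<Sum>S | S \<subseteq> ?B \<and> card S = Suc j. q ^ cross S (?B - S)) =
      (\<Sum>S\<in>?P (Suc j). q ^ cross S (?B - S)) + (\<Sum>S\<in>insert ?n ` ?P j. q ^ cross S (?B - S))"
      unfolding eq by (intro sum.union_disjoint) auto
    also have "(\<Sum>S\<in>?P (Suc j). q ^ cross S (?B - S)) = qbinom m (Suc j) q"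
      unfolding Suc.IH[symmetric] using c1 by (intro sum.cong) auto
    also have "(\<Sum>S\<in>insert ?n ` ?P j. q ^ cross S (?B - S)) = (\<Sum>S\<in>?P j. q ^ (m - j) * q ^ cross S (?A - S))"
      using c2 by (subst sum.reindex[OF inj]) (auto simp: power_add simp del: Diff_insert intro!: sum.cong)
    also have "\<dots> = q ^ (m - j) * qbinom m j q"
      by (simp add: Suc.IH flip: sum_distrib_left)
    also have "qbinom m (Suc j) q + q ^ (m - j) * qbinom m j q = qbinom (Suc m) (Suc j) q"
    \<comment> \<open>For \<open>j > m\<close> all three coefficients vanish.\<close>
    proof (cases "j \<le> m")
      case True
      then show ?thesis by (simp add: qbinom_pascal(1)[OF q])
    qed (simp add: qbinom_eq_0)
    finally show ?thesis using Suc by simp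
  qed
qed


section \<open>Words with exactly one M-descent\<close>

lemma sum_list_length_filter_eq_cross:
  assumes "distinct v" "distinct z"
  shows "(\<Sum>x\<leftarrow>v. length (filter (\<lambda>y. y < x) z)) = cross (set v) (set z)"
proof -
  have "length (filter (\<lambda>y. y < x) z) = card {t \<in> set z. t < x}" for x
    using assms(2) by (simp add: Int_def conj_commute flip: distinct_card)
  then show ?thesis using assms(1) by (simp add: cross_def sum_list_distinct_conv_sum_set)
qed

lemma filter_shuffle_separated:
  assumes "v \<in> shuffles xs ys" "\<And>x. x \<in> set xs \<Longrightarrow> P x" "\<And>y. y \<in> set ys \<Longrightarrow> \<not> P y"
  shows "filter P v = xs" and "filter (\<lambda>y. \<not> P y) v = ys"
proof -
  have "filter P xs = xs" "filter P ys = []" "filter (\<lambda>y. \<not> P y) xs = []" "filter (\<lambda>y. \<not> P y) ys = ys"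
    using assms(2,3) by (auto simp: filter_id_conv filter_empty_conv)
  then have "filter P v \<in> shuffles xs []" "filter (\<lambda>y. \<not> P y) v \<in> shuffles [] ys"
    using assms(1) filter_shuffles[of P xs ys] filter_shuffles[of "\<lambda>y. \<not> P y" xs ys] by auto
  then show "filter P v = xs" "filter (\<lambda>y. \<not> P y) v = ys" by simp_all
qed


text \<open>Behind a letter \<open>a\<close> of \<open>xs\<close>, the letters below
  \<open>a\<close> all come from \<open>ys\<close>. Behind a letter of \<open>ys\<close> they come
  from \<open>xs\<close> and then from \<open>z\<close>, which is not smaller. Both lists are
  increasing.\<close>

lemma av321_shuffle_append:
  assumes "v \<in> shuffles xs ys" "sorted xs" "sorted ys" "sorted z"
    "\<And>x t. x \<in> set xs \<Longrightarrow> t \<in> set z \<Longrightarrow> x \<le> t"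
  shows "av321 (v @ z)"
  using assms
proof (induction v arbitrary: xs ys)
  case Nil
  then show ?case by (simp add: sorted_imp_av321)
next
  case (Cons a v)
  let ?f = "filter (\<lambda>y. y < a)"
  from Cons.prems(1) consider xs' where "xs = a # xs'" "v \<in> shuffles xs' ys"
    | ys' where "ys = a # ys'" "v \<in> shuffles xs ys'"
    unfolding Cons_in_shuffles_iff by (metis list.collapse)
  then show ?case
  proof cases
    case 1
    have "?f xs' = []" "?f z = []"
      using 1 Cons.prems by (auto simp: filter_empty_conv not_less)
    moreover from this have "?f v = ?f ys"
      using 1(2) filter_shuffles[of "\<lambda>y. y < a" xs' ys] by auto
    moreover have "av321 (v @ z)" using 1 Cons.prems by (intro Cons.IH[of xs' ys]) auto
    ultimately show ?thesis using Cons.prems(3) by (simp add: sorted_wrt_filter)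
  next
    case 2
    have "?f ys' = []" using 2 Cons.prems by (auto simp: filter_empty_conv not_less)
    then have "?f v = ?f xs"
      using 2(2) filter_shuffles[of "\<lambda>y. y < a" xs ys'] by auto
    moreover have "av321 (v @ z)" using 2 Cons.prems by (intro Cons.IH[of xs ys']) auto
    ultimately show ?thesis using Cons.prems by (auto simp: sorted_append sorted_wrt_filter)
  qed
qed

text \<open>
  A word with a single descent among the letters above \<open>L\<close> is a shuffle \<open>v\<close> of \<open>1, \<dots>, L\<close> with an
  increasing word on \<open>S\<close>, followed by the increasing word on the complement of \<open>S\<close>; the excluded
  set is the one that would produce no descent.
\<close>

lemma one_descent_word:
  fixes L m i :: nat
  defines "T \<equiv> {Suc L..<Suc L + m}"
  assumes S: "S \<subseteq> T" "card S = i" "S \<noteq> {Suc L..<Suc L + i}" and i: "1 \<le> i" "i < m"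
    and v: "v \<in> shuffles [1..<Suc L] (sorted_list_of_set S)"
  defines "u \<equiv> v @ sorted_list_of_set (T - S)"
  shows "u \<in> LM_words L m" "des (filter (\<lambda>y. L < y) u) = 1"
    "runlen (filter (\<lambda>y. L < y) u) = m - i"
    "filter (\<lambda>y. L < y) v = sorted_list_of_set S" "invs u = invs v + cross S (T - S)"
    "length (sorted_list_of_set (T - S)) = m - i"
proof -
  let ?z = "sorted_list_of_set (T - S)" and ?s = "sorted_list_of_set S" and ?m = "filter (\<lambda>y. L < y)"
  have fin [simp]: "finite T" "finite S" using S(1) by (auto simp: T_def intro: finite_subset)
  have cardT: "card T = m" by (simp add: T_def)
  show lz: "length ?z = m - i" using S cardT by (simp add: card_Diff_subset)
  have ls: "length ?s = i" using S by simp
  have gt: "L < y" if "y \<in> T" for y using that by (simp add: T_def)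
  have "filter (\<lambda>y. \<not> y \<le> L) v = ?s" and fv: "filter (\<lambda>y. y \<le> L) v = [1..<Suc L]"
    by (rule filter_shuffle_separated[OF v]; use S(1) gt in \<open>force simp del: upt_Suc\<close>)+
  then show mv: "?m v = ?s" by (simp add: not_le)
  have mz: "?m ?z = ?z" using gt by (simp add: filter_id_conv)
  have mu: "?m u = ?s @ ?z" by (simp add: u_def mv mz)
  have sv: "set v = {1..<Suc L} \<union> S" using set_shuffles[OF v] by (simp del: upt_Suc)
  have dv: "distinct v"
    by (rule distinct_disjoint_shuffles[OF _ _ _ v]) (use S(1) gt in \<open>force simp del: upt_Suc\<close>)+
  have su: "set u = {1..L + m}"
    using S(1) by (auto simp: u_def sv T_def)
  have du: "distinct u" using dv S(1) gt by (force simp: u_def sv)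
  \<comment> \<open>Otherwise \<open>S\<close> would be the initial interval of length
    \<open>i\<close>, which is excluded.\<close>
  have "?s @ ?z \<noteq> [Suc L..<Suc L + m]"
  proof
    assume "?s @ ?z = [Suc L..<Suc L + m]"
    then have "take i (?s @ ?z) = take i [Suc L..<Suc L + m]" by (rule arg_cong)
    then have "?s = [Suc L..<Suc L + i]" using ls i by (simp add: take_upt del: upt_Suc)
    then have "set ?s = {Suc L..<Suc L + i}" by (simp only: set_upt)
    with S(3) show False by simp
  qed
  moreover have "set (?s @ ?z) = set [Suc L..<Suc L + m]" "distinct (?s @ ?z)"
    using S(1) by (auto simp: T_def)
  ultimately have ns: "\<not> sorted (?s @ ?z)"
    using sorted_distinct_set_unique[of "?s @ ?z" "[Suc L..<Suc L + m]"] by (metis distinct_upt sorted_upt)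
  then have d1: "des (?s @ ?z) \<noteq> 0" by (simp only: des_0_iff not_False_eq_True)
  have ds: "des ?s = 0" by (simp add: des_0_iff)
  have dsz: "des (?s @ ?z) = (if ?s \<noteq> [] \<and> ?z \<noteq> [] \<and> hd ?z < last ?s then 1 else 0)"
    by (subst des_append_sorted) (simp_all only: ds sorted_sorted_list_of_set)
  \<comment> \<open>Both pieces are increasing, so the descent can only be at their
    junction.\<close>
  with d1 have hz: "?s \<noteq> [] \<and> ?z \<noteq> [] \<and> hd ?z < last ?s" by presburger
  with dsz show "des (?m u) = 1" unfolding mu by presburger
  from hz have "runlen (?s @ ?z) = length ?z"
    by (intro runlen_append_descent sorted_sorted_list_of_set) blast+
  then show "runlen (?m u) = m - i" unfolding mu lz .
  have "filter (\<lambda>y. y \<le> L) ?z = []" using gt by (force simp: filter_empty_conv)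
  then have "filter (\<lambda>y. y \<le> L) u = [1..<Suc L]" using fv by (simp add: u_def del: upt_Suc)
  moreover have "av321 u"
    unfolding u_def by (rule av321_shuffle_append[OF v]) (use gt in \<open>force simp del: upt_Suc\<close>)+
  ultimately show "u \<in> LM_words L m"
    using su du by (simp add: LM_words_def permutations_of_set_def sorted_upt del: upt_Suc)
  \<comment> \<open>The L-letters of \<open>v\<close> lie below all of \<open>T\<close> and
    contribute no inversion.\<close>
  have "cross (set v) (set ?z) = cross S (T - S)"
  proof -
    have fz: "set ?z = T - S" by simp
    have "{t \<in> T - S. t < x} = {}" if "x \<in> {1..<Suc L} \<union> S - S" for x
      using gt that by force
    then have "\<forall>x\<in>{1..<Suc L} \<union> S - S. card {t \<in> T - S. t < x} = 0"
      by (intro ballI) (simp only: card.empty)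
    then show ?thesis
      unfolding cross_def sv fz by (intro sum.mono_neutral_right finite_UnI) (use fin in simp_all)
  qed
  then show "invs u = invs v + cross S (T - S)"
    using dv by (simp add: u_def invs_append sorted_imp_invs sum_list_length_filter_eq_cross)
qed


text \<open>Words correspond to triples \<open>(i, S, v)\<close>, where \<open>i\<close> M-letters
  forming the set \<open>S\<close> precede the last run. Summing over \<open>v\<close> gives the
  shuffle coefficient, summing over \<open>S\<close> the subset coefficient less the term of the
  excluded interval. The run length is \<open>m - i\<close>, so any \<open>f\<close> of it can be
  carried along.\<close>

lemma sum_one_descent:
  fixes q :: "'a::field"
  assumes q: "\<forall>n>0. q ^ n \<noteq> 1"
  shows "(\<Sum>u | u \<in> LM_words L m \<and> des (filter (\<lambda>y. L < y) u) = 1.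
      q ^ invs u * f (runlen (filter (\<lambda>y. L < y) u))) =
    (\<Sum>i\<in>{1..<m}. qbinom (L + i) L q * (qbinom m i q - 1) * f (m - i))"
proof -
  let ?T = "{Suc L..<Suc L + m}" and ?m = "filter (\<lambda>y. L < y)"
  let ?I = "\<lambda>i. {Suc L..<Suc L + i}"
  let ?Q = "\<lambda>i. {S. S \<subseteq> ?T \<and> card S = i \<and> S \<noteq> ?I i}"
  let ?V = "\<lambda>S. shuffles [1..<Suc L] (sorted_list_of_set S)"
  let ?E = "SIGMA i:{1..<m}. SIGMA S:?Q i. ?V S"
  let ?U = "{u \<in> LM_words L m. des (?m u) = 1}"
  let ?c = "\<lambda>u. take (length u - runlen (?m u)) u"
  have fin: "finite S" if "S \<subseteq> ?T" for S using that by (rule finite_subset) simp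
  have fwd: "v @ sorted_list_of_set (?T - S) \<in> ?U"
    "?c (v @ sorted_list_of_set (?T - S)) = v"
    "?m v = sorted_list_of_set S"
    "runlen (?m (v @ sorted_list_of_set (?T - S))) = m - i"
    "invs (v @ sorted_list_of_set (?T - S)) = invs v + cross S (?T - S)"
    if "i \<in> {1..<m}" "S \<in> ?Q i" "v \<in> ?V S" for i S v
  proof -
    have a: "S \<subseteq> ?T" "card S = i" "S \<noteq> ?I i" "1 \<le> i" "i < m" using that by auto
    note w = one_descent_word[OF a that(3)]
    show "v @ sorted_list_of_set (?T - S) \<in> ?U" using w(1,2) by blast
    show "?m v = sorted_list_of_set S" by (rule w(4))
    show "runlen (?m (v @ sorted_list_of_set (?T - S))) = m - i" by (rule w(3))
    show "invs (v @ sorted_list_of_set (?T - S)) = invs v + cross S (?T - S)" by (rule w(5))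
    show "?c (v @ sorted_list_of_set (?T - S)) = v"
      unfolding w(3) length_append w(6) by simp
  qed
  \<comment> \<open>The inverse map: cut off the last run, a suffix of the word; \<open>S\<close> is
    the set of M-letters left over and \<open>i\<close> its size.\<close>
  have bwd: "(card (set (?m (?c u))), set (?m (?c u)), ?c u) \<in> ?E"
    "?c u @ sorted_list_of_set (?T - set (?m (?c u))) = u" if "u \<in> ?U" for u
  proof -
    have av: "av321 u" and d: "distinct u" and su: "set u = {1..L + m}"
      and sL: "sorted (filter (\<lambda>y. y \<le> L) u)" and des: "des (?m u) = 1"
      using that by (auto simp: LM_words_def permutations_of_set_def)
    have "\<not> sorted (?m u)" using des des_0_iff[of "?m u"] by simp
    then obtain c z where cz: "u = c @ z" "sorted z" "z \<noteq> []" "\<And>y. y \<in> set z \<Longrightarrow> L < y"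
      "?m c \<noteq> []" "hd z < last (?m c)" "runlen (?m u) = length z" "des (?m u) = Suc (des (?m c))"
      using last_run_decomp[OF av] by metis
    have c: "?c u = c" unfolding cz(7) by (simp add: cz(1))
    define S where "S = set (?m c)"
    have "set z \<inter> set c = {}" "distinct c" "distinct z" using d cz(1) by auto
    have sT: "S \<union> set z = ?T" 
    proof -
      have "S \<union> set z = {y \<in> set u. L < y}" using cz(1,4) by (auto simp: S_def)
      also have "\<dots> = ?T" unfolding su by auto
      finally show ?thesis .
    qed
    have zT: "set z = ?T - S" using sT \<open>set z \<inter> set c = {}\<close> by (auto simp: S_def)
    have z: "sorted_list_of_set (?T - S) = z"
      unfolding zT[symmetric] using cz(2) \<open>distinct z\<close> by (rule sorted_list_of_set.idem_if_sorted_distinct)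
    have "sorted (?m c)" using des cz(8) des_0_iff[of "?m c"] by simp
    then have s: "sorted_list_of_set S = ?m c"
      unfolding S_def using \<open>distinct c\<close> by (intro sorted_list_of_set.idem_if_sorted_distinct) auto
    have "filter (\<lambda>y. y \<le> L) c = [1..<Suc L]"
    proof (rule sorted_distinct_set_unique)
      have "filter (\<lambda>y. y \<le> L) z = []" using cz(4) by (force simp: filter_empty_conv)
      then have *: "filter (\<lambda>y. y \<le> L) u = filter (\<lambda>y. y \<le> L) c" by (simp add: cz(1))
      with sL show "sorted (filter (\<lambda>y. y \<le> L) c)" by simp
      have "set (filter (\<lambda>y. y \<le> L) u) = set [1..<Suc L]" using su by (auto simp del: upt_Suc)
      with * show "set (filter (\<lambda>y. y \<le> L) c) = set [1..<Suc L]" by (simp only:)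
    qed (use \<open>distinct c\<close> in \<open>auto simp: sorted_upt simp del: upt_Suc\<close>)
    then have V: "c \<in> ?V S"
      using partition_in_shuffles[of c "\<lambda>y. y \<le> L"] s by (simp add: not_le del: upt_Suc)
    have S: "S \<subseteq> ?T" using sT by blast
    have "last (?m c) \<in> S" using cz(5) unfolding S_def by (rule last_in_set)
    have hz: "hd z \<in> ?T" "hd z \<notin> S" using cz(3) zT list.set_sel(1)[of z] by auto
    \<comment> \<open>An initial interval lies below its complement, whereas here the last M-letter
      of \<open>c\<close> exceeds the head of \<open>z\<close>.\<close>
    have "S \<noteq> ?I (card S)"
    proof
      assume "S = ?I (card S)"
      with \<open>last (?m c) \<in> S\<close> hz cz(6) show False by (metis atLeastLessThan_iff less_trans)
    qed
    moreover have "card S < card ?T" using S hz by (intro psubset_card_mono) auto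
    moreover have "card S \<noteq> 0" using \<open>last (?m c) \<in> S\<close> fin[OF S] by auto
    ultimately have "card S \<in> {1..<m}" "S \<in> ?Q (card S)" using S by auto
    with V show "(card (set (?m (?c u))), set (?m (?c u)), ?c u) \<in> ?E"
      unfolding c S_def[symmetric] by blast
    show "?c u @ sorted_list_of_set (?T - set (?m (?c u))) = u"
      unfolding c S_def[symmetric] z by (simp add: cz(1))
  qed
  have "(\<Sum>u\<in>?U. q ^ invs u * f (runlen (?m u))) =
    (\<Sum>(i, S, v)\<in>?E. q ^ invs v * q ^ cross S (?T - S) * f (m - i))"
  proof (rule sum.reindex_bij_witness[where i = "\<lambda>(i, S, v). v @ sorted_list_of_set (?T - S)"
        and j = "\<lambda>u. (card (set (?m (?c u))), set (?m (?c u)), ?c u)"])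
    fix u assume u: "u \<in> ?U"
    note b = bwd[OF u]
    show "(case (card (set (?m (?c u))), set (?m (?c u)), ?c u) of
        (i, S, v) \<Rightarrow> v @ sorted_list_of_set (?T - S)) = u"
      unfolding prod.case by (rule b(2))
    show "(card (set (?m (?c u))), set (?m (?c u)), ?c u) \<in> ?E" by (rule b(1))
    from b(1) have "card (set (?m (?c u))) \<in> {1..<m}" "set (?m (?c u)) \<in> ?Q (card (set (?m (?c u))))"
      "?c u \<in> ?V (set (?m (?c u)))" by blast+
    from fwd(4,5)[OF this] show "(case (card (set (?m (?c u))), set (?m (?c u)), ?c u) of
        (i, S, v) \<Rightarrow> q ^ invs v * q ^ cross S (?T - S) * f (m - i)) = q ^ invs u * f (runlen (?m u))"
      unfolding prod.case b(2) by (simp only: power_add)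
  next
    fix e assume "e \<in> ?E"
    then obtain i S v where e: "e = (i, S, v)" "i \<in> {1..<m}" "S \<in> ?Q i" "v \<in> ?V S" by blast
    note w = fwd[OF e(2-4)]
    show "(case e of (i, S, v) \<Rightarrow> v @ sorted_list_of_set (?T - S)) \<in> ?U"
      unfolding e(1) prod.case by (rule w(1))
    have "finite S" "card S = i" using e(3) fin by blast+
    let ?w = "case e of (i, S, v) \<Rightarrow> v @ sorted_list_of_set (?T - S)"
    show "(card (set (?m (?c ?w))), set (?m (?c ?w)), ?c ?w) = e"
      unfolding e(1) prod.case w(2,3) using \<open>finite S\<close> \<open>card S = i\<close> by simp
  qed
  also have "\<dots> = (\<Sum>i\<in>{1..<m}. \<Sum>S\<in>?Q i. \<Sum>v\<in>?V S. q ^ invs v * q ^ cross S (?T - S) * f (m - i))"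
    by (simp add: sum.Sigma del: upt_Suc)
  also have "\<dots> = (\<Sum>i\<in>{1..<m}. qbinom (L + i) L q * (qbinom m i q - 1) * f (m - i))"
  proof (rule sum.cong[OF refl])
    fix i assume i: "i \<in> {1..<m}"
    have "(\<Sum>v\<in>?V S. q ^ invs v * q ^ cross S (?T - S) * f (m - i)) =
        qbinom (L + i) L q * f (m - i) * q ^ cross S (?T - S)" if "S \<in> ?Q i" for S
    proof -
      have "(\<Sum>v\<in>?V S. q ^ invs v) =
          qbinom (length [1..<Suc L] + length (sorted_list_of_set S)) (length [1..<Suc L]) q"
        using that fin by (intro sum_shuffles_invs[OF q]) (auto simp del: upt_Suc)
      also have "\<dots> = qbinom (L + i) L q" using that by (simp del: upt_Suc)
      finally show ?thesis by (simp add: mult_ac del: upt_Suc flip: sum_distrib_left sum_distrib_right)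
    qed
    then have "(\<Sum>S\<in>?Q i. \<Sum>v\<in>?V S. q ^ invs v * q ^ cross S (?T - S) * f (m - i)) =
        qbinom (L + i) L q * f (m - i) * (\<Sum>S\<in>?Q i. q ^ cross S (?T - S))"
      unfolding sum_distrib_left by (rule sum.cong[OF refl])
    also have "(\<Sum>S\<in>?Q i. q ^ cross S (?T - S)) = qbinom m i q - 1"
    proof -
      let ?P = "{S. S \<subseteq> ?T \<and> card S = i}"
      have I: "?I i \<in> ?P" using i by auto
      \<comment> \<open>The excluded interval contributes \<open>q ^ 0\<close>, which is the 1
        subtracted in \<open>E0\<close>.\<close>
      have "cross (?I i) (?T - ?I i) = 0" by (auto simp: cross_def)
      moreover have "?Q i = ?P - {?I i}" by auto
      ultimately have "(\<Sum>S\<in>?P. q ^ cross S (?T - S)) = 1 + (\<Sum>S\<in>?Q i. q ^ cross S (?T - S))"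
        using sum.remove[OF _ I, of "\<lambda>S. q ^ cross S (?T - S)"] by simp
      then have "qbinom m i q = 1 + (\<Sum>S\<in>?Q i. q ^ cross S (?T - S))"
        unfolding sum_subsets_cross[OF q] .
      then have "qbinom m i q - 1 = 1 + (\<Sum>S\<in>?Q i. q ^ cross S (?T - S)) - 1" by (simp only:)
      then show ?thesis unfolding add_diff_cancel_left' ..
    qed
    finally show "(\<Sum>S\<in>?Q i. \<Sum>v\<in>?V S. q ^ invs v * q ^ cross S (?T - S) * f (m - i)) =
        qbinom (L + i) L q * (qbinom m i q - 1) * f (m - i)" by (simp add: mult_ac)
  qed
  finally show ?thesis .
qed


section \<open>The functional equation\<close>

text \<open>Without M-letters there are no descents, so the value 0 prescribed at
  \<open>M = 0\<close> fits the same formula and the recursion may start there.\<close>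

lemma fps_nth_F0:
  "fps_nth (F0 L R q r) M =
    (\<Sum>u | u \<in> LM_words L M \<and> 2 \<le> des (filter (\<lambda>y. L < y) u).
      q ^ invs u * r ^ runlen (filter (\<lambda>y. L < y) u))" (is "_ = ?T M")
proof (cases "M = 0")
  case True
  have "filter (\<lambda>y. L < y) u = []" if "u \<in> LM_words L 0" for u
    using that by (auto simp: LM_words_def permutations_of_set_def filter_empty_conv)
  then have "{u. u \<in> LM_words L 0 \<and> 2 \<le> des (filter (\<lambda>y. L < y) u)} = {}"
    by fastforce
  then have "?T 0 = 0" by (simp only: sum.empty)
  with True show ?thesis by (simp add: F0_def)
next
  case False
  then show ?thesis by (simp add: F0_def sum_F0_words)
qed

lemma sum_powers_from_1:
  fixes z :: "'a::field"
  assumes "z \<noteq> 1"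
  shows "(\<Sum>k\<in>{1..n}. z ^ k) = z / (1 - z) * (1 - z ^ n)"
proof -
  have "(1 - z) * (\<Sum>k\<in>{1..n}. z ^ k) = z * (1 - z ^ n)"
  proof (induction n)
    case (Suc n)
    have "(1 - z) * (\<Sum>k\<in>{1..Suc n}. z ^ k) = z * (1 - z ^ n) + (1 - z) * z ^ Suc n"
      using Suc by (simp add: distrib_left)
    also have "\<dots> = z * (1 - z ^ Suc n)" by (simp add: algebra_simps)
    finally show ?case .
  qed simp
  with assms show ?thesis by (simp add: eq_divide_eq mult.commute)
qed

text \<open>The equation with \<open>1 - x r\<close> cleared, compared coefficientwise; at exponent
  \<open>Suc M\<close> it is the insertion recursion.\<close>

lemma F0_functional_equation:
  fixes q r :: "'a::field"
  assumes q: "\<forall>n>0. q ^ n \<noteq> 1" and qr: "q * r \<noteq> 1"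
  shows "(1 - fps_X * fps_const r) * F0 L R q r =
    E0 L q r + fps_X * fps_const (q * r / (1 - q * r)) * (F0 L R q 1 - F0 L R q (q * r))"
proof (rule fps_ext)
  fix n
  let ?c = "q * r / (1 - q * r)"
  let ?F = "\<lambda>r. fps_nth (F0 L R q r)"
  show "fps_nth ((1 - fps_X * fps_const r) * F0 L R q r) n =
    fps_nth (E0 L q r + fps_X * fps_const ?c * (F0 L R q 1 - F0 L R q (q * r))) n"
  proof (cases n)
    case 0
    then show ?thesis by (simp add: E0_def F0_def)
  next
    case (Suc M)
    let ?m = "filter (\<lambda>y. L < y)"
    let ?U = "{u. u \<in> LM_words L M \<and> 2 \<le> des (?m u)}"
    have "?F r (Suc M) = (\<Sum>u\<in>?U. q ^ invs u *
          (r ^ Suc (runlen (?m u)) + (\<Sum>k\<in>{1..runlen (?m u)}. (q * r) ^ k))) +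
        (\<Sum>u | u \<in> LM_words L M \<and> des (?m u) = 1.
          q ^ invs u * (\<Sum>k\<in>{1..<runlen (?m u)}. (q * r) ^ k))"
      unfolding fps_nth_F0 by (rule sum_two_descents_Suc)
    \<comment> \<open>The geometric sum is \<open>?c * (1 - (q * r) ^ a)\<close> for a run of length
      \<open>a\<close>. Writing its first term with \<open>1 ^ a\<close> exhibits the values of
      \<open>F0\<close> at \<open>1\<close> and at \<open>q * r\<close>.\<close>
    also have "(\<Sum>u\<in>?U. q ^ invs u *
          (r ^ Suc (runlen (?m u)) + (\<Sum>k\<in>{1..runlen (?m u)}. (q * r) ^ k))) =
        (\<Sum>u\<in>?U. r * (q ^ invs u * r ^ runlen (?m u)) +
          ?c * (q ^ invs u * 1 ^ runlen (?m u) - q ^ invs u * (q * r) ^ runlen (?m u)))"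
      unfolding sum_powers_from_1[OF qr] by (intro sum.cong refl) (simp add: algebra_simps)
    also have "\<dots> = r * ?F r M + ?c * (?F 1 M - ?F (q * r) M)"
      unfolding fps_nth_F0 sum.distrib sum_distrib_left[symmetric] sum_subtractf ..
    \<comment> \<open>With run length \<open>m - i\<close>, the geometric sum up to
      \<open>a - 1\<close> becomes the inner sum of \<open>E0\<close>.\<close>
    also have "(\<Sum>u | u \<in> LM_words L M \<and> des (?m u) = 1.
          q ^ invs u * (\<Sum>k\<in>{1..<runlen (?m u)}. (q * r) ^ k)) = fps_nth (E0 L q r) (Suc M)"
      unfolding sum_one_descent[OF q, where f = "\<lambda>a. \<Sum>k\<in>{1..<a}. (q * r) ^ k"]
      by (simp add: E0_def power_mult_distrib)
    finally show ?thesis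
      using Suc by (simp add: left_diff_distrib mult.assoc)
  qed
qed

text \<open>As a polynomial in the inner variable, the \<open>n\<close>-th power has degree
  \<open>n > 0\<close>, while 1 has degree 0.\<close>

lemma q_var_power_neq_1: "0 < n \<Longrightarrow> q_var ^ n \<noteq> 1"
proof
  assume n: "0 < n" "q_var ^ n = 1"
  have "q_var ^ n = Fract ([:[:0, 1:]:] ^ n) 1" for n
    by (induction n) (simp_all add: q_var_def One_fract_def)
  with n(2) have "([:[:0, 1:]:] :: int poly poly) ^ n = 1"
    by (simp add: One_fract_def eq_fract)
  then have "[:[:0, 1:] ^ n:] = (1 :: int poly poly)" by (simp add: poly_const_pow)
  then have "[:0, 1:] ^ n = (1 :: int poly)" by (simp add: one_pCons)
  then have "degree ([:0, 1:] ^ n :: int poly) = 0" by simp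
  with n(1) show False by (simp add: degree_power_eq)
qed

lemma q_var_r_var_neq_1: "q_var * r_var \<noteq> 1"
proof
  assume "q_var * r_var = 1"
  then have "[:[:0, 1:]:] * [:0, 1:] = (1 :: int poly poly)"
    by (simp add: q_var_def r_var_def One_fract_def eq_fract)
  \<comment> \<open>Setting the outer variable \<open>r\<close> to 0 turns the assumption into
    \<open>0 = 1\<close>.\<close>
  then have "poly ([:[:0, 1:]:] * [:0, 1:]) 0 = poly (1 :: int poly poly) 0" by (rule arg_cong)
  then show False by simp
qed

theorem theorem4p4:
  fixes L R :: nat
    and q r :: ratfun_qr
    and x qr' r' :: "ratfun_qr fps"
  assumes "L \<ge> 1" and "R \<ge> 1"
  defines "q \<equiv> q_var" and "r \<equiv> r_var"
  defines "x \<equiv> fps_X" and "r' \<equiv> fps_const r" and "qr' \<equiv> fps_const (q * r)"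
  shows "F0 L R q r =
           E0 L q r / (1 - x * r')
           + x * qr' / ((1 - qr') * (1 - x * r')) * F0 L R q 1
           - x * qr' / ((1 - qr') * (1 - x * r')) * F0 L R q (q * r)"
proof -
  let ?D = "1 - x * r'"
  have q: "\<forall>n>0. q ^ n \<noteq> 1" and qr: "q * r \<noteq> 1"
    by (simp_all add: q_def r_def q_var_power_neq_1 q_var_r_var_neq_1)
  \<comment> \<open>Both denominators have nonzero constant term, hence are units, and division of
    power series is multiplication by the inverse.\<close>
  have D0: "fps_nth ?D 0 \<noteq> 0" by (simp add: x_def)
  have c0: "fps_nth (1 - qr') 0 \<noteq> 0" using qr by (simp add: qr'_def)
  have e: "1 - qr' = fps_const (1 - q * r)"
    by (simp add: qr'_def flip: fps_const_1_eq_1 fps_const_sub)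
  have c: "fps_const (q * r / (1 - q * r)) = qr' * inverse (1 - qr')"
    unfolding e by (simp add: qr'_def fps_const_inverse divide_inverse)
  have "F0 L R q r = inverse ?D * (?D * F0 L R q r)"
    using D0 by (simp add: inverse_mult_eq_1 flip: mult.assoc)
  also have "?D * F0 L R q r =
      E0 L q r + x * (qr' * inverse (1 - qr')) * (F0 L R q 1 - F0 L R q (q * r))"
    unfolding x_def r'_def c[symmetric] by (rule F0_functional_equation[OF q qr])
  also have "inverse ?D * (E0 L q r + x * (qr' * inverse (1 - qr')) * (F0 L R q 1 - F0 L R q (q * r))) =
      E0 L q r * inverse ?D
      + x * qr' * (inverse (1 - qr') * inverse ?D) * F0 L R q 1
      - x * qr' * (inverse (1 - qr') * inverse ?D) * F0 L R q (q * r)"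
    by (simp only: algebra_simps)
  finally show ?thesis
    using D0 c0 by (simp only: fps_divide_unit fps_inverse_mult fps_mult_nth_0 mult_eq_0_iff simp_thms)
qed

end
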